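(* $\mathrm{VCdim}^-\equiv_{\mathrm{sW}}\mathrm{VCdim}'\equiv_{\mathrm{sW}}\mathsf{SORT}'$.
   Context: Weihrauch reducibility: a represented space is a set $X$ with a surjective partial map $\delta_X:\subseteq\mathbb{N}^\mathbb{N}\to X$. A problem is a partial multivalued map $f:\subseteq X\rightrightarrows Y$; $F$ realizes $f$ if $\delta_Y F(p)\in f(\delta_X(p))$ for all $p\in\mathrm{dom}(f\circ\delta_X)$. $f\le_{\mathrm{sW}}g$ if there are computable $H,K:\subseteq\mathbb{N}^\mathbb{N}\to\mathbb{N}^\mathbb{N}$ with $HGK$ realizing $f$ whenever $G$ realizes $g$; $\equiv_{\mathrm{sW}}$ is the induced equivalence. Jump: $\lim:\subseteq\mathbb{N}^\mathbb{N}\to\mathbb{N}^\mathbb{N}$, $\langle p_0,p_1,\dots\rangle\mapsto\lim_i p_i$ (limit in Baire space, defined for convergent sequences; $\langle\cdot\rangle$ standard tupling). For a represented space $(X,\delta)$, $X'=(X,\delta\circ\lim)$, and for a problem $f:\subseteq X\rightrightarrows Y$ the jump $f':\subseteq X'\rightrightarrows Y$ is the same map with input space $X'$. Closed sets: fix a computable bijective enumeration $n\mapsto w_n$ of $\{0,1\}^*$, $B_n=w_n2^\mathbb{N}$. $\mathcal{A}_+$: closed subsets of $2^\mathbb{N}$, $p$ names $A$ iff $\{n:n+1\in\mathrm{range}(p)\}=\{n:B_n\cap A\neq\emptyset\}$; $\mathcal{A}_-$: $p$ names $2^\mathbb{N}\setminus\bigcup_{n+1\in\mathrm{range}(p)}B_n$;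 $\mathcal{A}$: $\langle p,q\rangle$ names $A$ iff $p$ names $A$ in $\mathcal{A}_+$ and $q$ in $\mathcal{A}_-$. VC dimension: elements of $2^\mathbb{N}$ are identified with subsets of $\mathbb{N}$; a finite $A\subseteq\mathbb{N}$ is shattered by $\mathcal{C}$ if $|\{B\cap A:B\in\mathcal{C}\}|=2^{|A|}$; $\mathrm{VCdim}(\mathcal{C})$ is the supremum of the sizes of shattered finite sets (in $\mathbb{N}\cup\{\infty\}$), $\mathrm{VCdim}(\emptyset)=0$. $\mathbb{N}_\infty=\mathbb{N}\cup\{\infty\}$ is represented by $0^n1p\mapsto n$, $\widehat{0}\mapsto\infty$. $\mathrm{VCdim}:\mathcal{A}\to\mathbb{N}_\infty$ and $\mathrm{VCdim}^-:\mathcal{A}_-\to\mathbb{N}_\infty$ are $\mathcal{C}\mapsto\mathrm{VCdim}(\mathcal{C})$ on the respective input spaces. $\mathsf{SORT}:2^\mathbb{N}\to2^\mathbb{N}$ maps $p$ to $\widehat{0}$ if $p$ has infinitely many zeros and to $0^n\widehat{1}$ if $p$ has exactly $n$ zeros. *)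

theory Defs
  imports "HOL-Analysis.Analysis" "HOL-Library.Nat_Bijection" "HOL-Library.Extended_Nat"
begin

section \<open>Computable partial functions on Baire space\<close>

type_synonym baire = "nat \<Rightarrow> nat"
type_synonym cantor = "nat \<Rightarrow> bool"

text \<open>
  Programs for the partial recursive functions relative to an oracle in Baire space (Kleene's
  schemata plus oracle access). The relation \<open>eval p c xs y\<close> says that program \<open>c\<close> with oracle \<open>p\<close>
  halts on the argument list \<open>xs\<close> with result \<open>y\<close>.
\<close>

datatype prog =
    Zero
  | Succ
  | Proj nat
  | Oracle
  | Comp prog "prog list"
  | PrimRec prog prog
  | Mu prog

inductive eval :: "baire \<Rightarrow> prog \<Rightarrow> nat list \<Rightarrow> nat \<Rightarrow> bool" for p :: baire where
  Zero: "eval p Zero xs 0"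
| Succ: "eval p Succ (x # xs) (Suc x)"
| Proj: "i < length xs \<Longrightarrow> eval p (Proj i) xs (xs ! i)"
| Oracle: "eval p Oracle (x # xs) (p x)"
| Comp: "length ys = length gs \<Longrightarrow> (\<And>i. i < length gs \<Longrightarrow> eval p (gs ! i) xs (ys ! i))
    \<Longrightarrow> eval p f ys z \<Longrightarrow> eval p (Comp f gs) xs z"
| PrimRec_0: "eval p f xs y \<Longrightarrow> eval p (PrimRec f g) (0 # xs) y"
| PrimRec_Suc: "eval p (PrimRec f g) (n # xs) y \<Longrightarrow> eval p g (n # y # xs) z
    \<Longrightarrow> eval p (PrimRec f g) (Suc n # xs) z"
| Mu: "eval p f (n # xs) 0 \<Longrightarrow> (\<And>m. m < n \<Longrightarrow> eval p f (m # xs) (Suc (v m)))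
    \<Longrightarrow> eval p (Mu f) xs n"

lemma eval_deterministic: "eval p c xs y \<Longrightarrow> eval p c xs z \<Longrightarrow> y = z"
proof (induction c xs y arbitrary: z rule: eval.induct)
  case (Comp ys gs xs f u)
  from Comp.prems obtain ys' where ys': "length ys' = length gs"
      "\<And>i. i < length gs \<Longrightarrow> eval p (gs ! i) xs (ys' ! i)" "eval p f ys' z"
    by (cases rule: eval.cases) auto
  have "ys = ys'"
    by (rule nth_equalityI) (use Comp ys' in auto)
  then show ?case using Comp.IH ys' by blast
next
  case (PrimRec_0 f xs y g)
  from PrimRec_0.prems show ?case
    by (cases rule: eval.cases) (use PrimRec_0.IH in auto)
next
  case (PrimRec_Suc f g n xs y u)
  from PrimRec_Suc.prems show ?case
    by (cases rule: eval.cases) (use PrimRec_Suc.IH in auto)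
next
  case (Mu f n xs v)
  from Mu.prems obtain v' where v': "eval p f (z # xs) 0"
      "\<And>m. m < z \<Longrightarrow> eval p f (m # xs) (Suc (v' m))"
    by (cases rule: eval.cases) auto
  have "\<not> n < z" using v'(2)[of n] Mu.IH(1)[of "Suc (v' n)"] by auto
  moreover have "\<not> z < n" using v'(1) Mu.IH(2)[of z 0] by auto
  ultimately show ?case by simp
next
  case (Zero xs) then show ?case by (cases rule: eval.cases) auto
next
  case (Succ x xs) then show ?case by (cases rule: eval.cases) auto
next
  case (Proj i xs) from Proj.prems show ?case by (cases rule: eval.cases) auto
next
  case (Oracle x xs) then show ?case by (cases rule: eval.cases) auto
qed

text \<open>As usual, nothing is required of the program outside the domain of the partial function.\<close>

definition computable :: "(baire \<rightharpoonup> baire) \<Rightarrow> bool" where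
  "computable F \<longleftrightarrow> (\<exists>c. \<forall>p q. F p = Some q \<longrightarrow> (\<forall>n. eval p c [n] (q n)))"

text \<open>
  A single function on the natural numbers is computable iff one program computes it whatever the
  oracle (equivalently, with the zero oracle).
\<close>

definition computable_seq :: "(nat \<Rightarrow> nat) \<Rightarrow> bool" where
  "computable_seq f \<longleftrightarrow> computable (\<lambda>_. Some f)"

section \<open>Problems and strong Weihrauch reducibility\<close>

text \<open>
  A represented space \<open>(X, \<delta>)\<close> is given by the partial map \<open>\<delta>\<close> alone; surjectivity
  means that \<open>X\<close> is \<open>ran \<delta>\<close>.
\<close>

type_synonym 'x representation = "baire \<rightharpoonup> 'x"

text \<open>The partial map sending \<open>p\<close> to the object that it names.\<close>

definition named_by :: "(baire \<Rightarrow> 'x \<Rightarrow> bool) \<Rightarrow> 'x representation" where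
  "named_by R p = (if \<exists>!x. R p x then Some (THE x. R p x) else None)"

lemma named_by_eq_Some_iff:
  assumes "\<And>x y. R p x \<Longrightarrow> R p y \<Longrightarrow> x = y"
  shows "named_by R p = Some x \<longleftrightarrow> R p x"
proof
  assume "named_by R p = Some x"
  then have "\<exists>!x. R p x" "(THE x. R p x) = x"
    by (auto simp: named_by_def split: if_splits)
  then show "R p x" using theI'[of "R p"] by simp
next
  assume "R p x"
  moreover from this assms have "\<exists>!x. R p x" by blast
  ultimately show "named_by R p = Some x"
    by (simp add: named_by_def the1_equality)
qed

text \<open>
  A multivalued map is a set-valued function. Only its values on \<open>ran (in_rep f)\<close> are
  relevant, and its domain consists of the points there that have a nonempty value.
\<close>

record ('x, 'y) problem =
  in_rep :: "'x representation"
  out_rep :: "'y representation"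
  mv :: "'x \<Rightarrow> 'y set"

definition realizes :: "(baire \<rightharpoonup> baire) \<Rightarrow> ('x, 'y) problem \<Rightarrow> bool" where
  "realizes F f \<longleftrightarrow> (\<forall>p x. in_rep f p = Some x \<and> mv f x \<noteq> {} \<longrightarrow>
     (\<exists>q y. F p = Some q \<and> out_rep f q = Some y \<and> y \<in> mv f x))"

definition sW_le :: "('x, 'y) problem \<Rightarrow> ('u, 'v) problem \<Rightarrow> bool" (infix "\<le>sW" 50) where
  "f \<le>sW g \<longleftrightarrow> (\<exists>H K. computable H \<and> computable K \<and>
     (\<forall>G. realizes G g \<longrightarrow> realizes (H \<circ>\<^sub>m G \<circ>\<^sub>m K) f))"

definition sW_equiv :: "('x, 'y) problem \<Rightarrow> ('u, 'v) problem \<Rightarrow> bool" (infix "\<equiv>sW" 50) where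
  "f \<equiv>sW g \<longleftrightarrow> f \<le>sW g \<and> g \<le>sW f"

definition single_valued_problem ::
    "'x representation \<Rightarrow> 'y representation \<Rightarrow> ('x \<Rightarrow> 'y) \<Rightarrow> ('x, 'y) problem" where
  "single_valued_problem \<delta>X \<delta>Y f = \<lparr>in_rep = \<delta>X, out_rep = \<delta>Y, mv = (\<lambda>x. {f x})\<rparr>"

section \<open>The jump\<close>

text \<open>Countable tupling: \<open>\<langle>p\<^sub>0, p\<^sub>1, \<dots>\<rangle>\<close> has the value \<open>p\<^sub>i(j)\<close> at the Cantor pair of \<open>i\<close> and \<open>j\<close>.\<close>

definition component :: "baire \<Rightarrow> nat \<Rightarrow> baire" where
  "component p i = (\<lambda>j. p (prod_encode (i, j)))"

definition lim_baire :: "baire \<rightharpoonup> baire" where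
  "lim_baire = named_by (\<lambda>p q. component p \<longlonglongrightarrow> q)"

definition jump :: "('x, 'y) problem \<Rightarrow> ('x, 'y) problem" where
  "jump f = f\<lparr>in_rep := in_rep f \<circ>\<^sub>m lim_baire\<rparr>"

lemma LIMSEQ_baire_iff:
  fixes s :: "nat \<Rightarrow> baire"
  shows "s \<longlonglongrightarrow> q \<longleftrightarrow> (\<forall>j. \<exists>N. \<forall>i\<ge>N. s i j = q j)"
  using limitin_componentwise[of "\<lambda>_. euclidean" UNIV s q sequentially]
  by (simp add: euclidean_product_topology tendsto_discrete eventually_sequentially)

lemma lim_baire_eq_Some_iff: "lim_baire p = Some q \<longleftrightarrow> component p \<longlonglongrightarrow> q"
  unfolding lim_baire_def
proof (rule named_by_eq_Some_iff)
  fix q r assume "component p \<longlonglongrightarrow> q" "component p \<longlonglongrightarrow> r"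
  show "q = r"
  proof
    fix j
    obtain M N where "\<forall>i\<ge>M. component p i j = q j" "\<forall>i\<ge>N. component p i j = r j"
      using \<open>component p \<longlonglongrightarrow> q\<close> \<open>component p \<longlonglongrightarrow> r\<close> unfolding LIMSEQ_baire_iff by blast
    then show "q j = r j" by (metis max.cobounded1 max.cobounded2)
  qed
qed

section \<open>Closed subsets of Cantor space\<close>

definition cylinder :: "bool list \<Rightarrow> cantor set" where
  "cylinder u = {x. \<forall>i<length u. x i = u ! i}"

text \<open>
  The parameter \<open>w\<close> is the enumeration of the binary words.
  Computability refers to the standard numbering of finite sequences.
\<close>

definition computable_enumeration :: "(nat \<Rightarrow> bool list) \<Rightarrow> bool" where
  "computable_enumeration w \<longleftrightarrow>
     computable_seq (\<lambda>n. list_encode (map (\<lambda>b. if b then 1 else 0) (w n)))"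

definition A_plus :: "(nat \<Rightarrow> bool list) \<Rightarrow> cantor set representation" where
  "A_plus w = named_by (\<lambda>p A. closed A \<and>
     {n. Suc n \<in> range p} = {n. cylinder (w n) \<inter> A \<noteq> {}})"

definition A_minus :: "(nat \<Rightarrow> bool list) \<Rightarrow> cantor set representation" where
  "A_minus w p = Some (UNIV - (\<Union>n\<in>{n. Suc n \<in> range p}. cylinder (w n)))"

text \<open>The pair \<open>\<langle>p, q\<rangle>\<close> has \<open>p\<close> at the even and \<open>q\<close> at the odd positions.\<close>

definition A_full :: "(nat \<Rightarrow> bool list) \<Rightarrow> cantor set representation" where
  "A_full w = named_by (\<lambda>r A.
     A_plus w (\<lambda>n. r (2 * n)) = Some A \<and> A_minus w (\<lambda>n. r (2 * n + 1)) = Some A)"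

lemma cylinder_eq_PiE:
  "cylinder u = PiE UNIV (\<lambda>i. if i < length u then {u ! i} else UNIV)"
  by (auto simp: cylinder_def PiE_iff split: if_splits)

lemma open_cylinder: "open (cylinder u)"
proof -
  have "{i. (if i < length u then {u ! i} else UNIV) \<noteq> (UNIV :: bool set)} \<subseteq> {..<length u}"
    by auto
  then have "finite {i. (if i < length u then {u ! i} else UNIV) \<noteq> (UNIV :: bool set)}"
    using finite_subset by blast
  then show ?thesis
    unfolding cylinder_eq_PiE by (intro open_PiE) (auto intro: open_discrete)
qed

lemma open_contains_cylinder:
  assumes "open U" "x \<in> U"
  shows "\<exists>k. cylinder (map x [0..<k]) \<subseteq> U"
proof -
  obtain X where X: "x \<in> PiE UNIV X" "finite {i. X i \<noteq> UNIV}" "PiE UNIV X \<subseteq> U"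
    using product_topology_open_contains_basis[of "\<lambda>_. euclidean" UNIV U x] assms
    unfolding open_fun_def by auto
  obtain k where k: "\<And>i. X i \<noteq> UNIV \<Longrightarrow> i < k"
    using finite_nat_set_iff_bounded[of "{i. X i \<noteq> UNIV}"] X(2) by auto
  have "cylinder (map x [0..<k]) \<subseteq> PiE UNIV X"
  proof
    fix y assume y: "y \<in> cylinder (map x [0..<k])"
    have "y i \<in> X i" for i
    proof (cases "i < k")
      case True
      then have "y i = x i" using y by (simp add: cylinder_def)
      then show ?thesis using X(1) by (auto simp: PiE_iff)
    next
      case False
      then have "X i = UNIV" using k by blast
      then show ?thesis by simp
    qed
    then show "y \<in> PiE UNIV X" by (simp add: PiE_iff)
  qed
  with X(3) show ?thesis by blast
qed

lemma closed_eq_if_same_cylinders: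
  assumes "surj w" "closed A" "closed B"
    "{n. cylinder (w n) \<inter> A \<noteq> {}} = {n. cylinder (w n) \<inter> B \<noteq> {}}"
  shows "A = B"
proof -
  have *: "C \<subseteq> D" if "closed D"
    and eq: "{n. cylinder (w n) \<inter> C \<noteq> {}} = {n. cylinder (w n) \<inter> D \<noteq> {}}" for C D
  proof (rule ccontr)
    assume "\<not> C \<subseteq> D"
    then obtain x where x: "x \<in> C" "x \<in> - D" by blast
    obtain k where k: "cylinder (map x [0..<k]) \<subseteq> - D"
      using open_contains_cylinder[of "- D" x] \<open>closed D\<close> x(2) by (auto simp: open_Compl)
    obtain n where n: "w n = map x [0..<k]" using \<open>surj w\<close> by (metis surjD)
    have "x \<in> cylinder (w n)" by (simp add: n cylinder_def)
    then have "n \<in> {n. cylinder (w n) \<inter> D \<noteq> {}}" using x(1) unfolding eq[symmetric] by blast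
    then show False using k unfolding n[symmetric] by blast
  qed
  show ?thesis
    by (rule subset_antisym[OF *[OF assms(3,4)] *[OF assms(2) assms(4)[symmetric]]])
qed

lemma A_plus_eq_Some_iff:
  assumes "surj w"
  shows "A_plus w p = Some A \<longleftrightarrow>
    closed A \<and> {n. Suc n \<in> range p} = {n. cylinder (w n) \<inter> A \<noteq> {}}"
  unfolding A_plus_def
  by (rule named_by_eq_Some_iff, elim conjE, rule closed_eq_if_same_cylinders[OF assms])
    (assumption | rule trans[OF sym])+

lemma A_full_eq_Some_iff:
  "A_full w r = Some A \<longleftrightarrow>
     A_plus w (\<lambda>n. r (2 * n)) = Some A \<and> A_minus w (\<lambda>n. r (2 * n + 1)) = Some A"
  unfolding A_full_def by (rule named_by_eq_Some_iff) simp

lemma ex_enumeration: "\<exists>p :: baire. {n. Suc n \<in> range p} = S"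
proof
  show "{n. Suc n \<in> range (\<lambda>n. if n \<in> S then Suc n else 0)} = S"
    by (auto simp: image_iff split: if_splits)
qed

lemma ran_A_full:
  assumes "surj w"
  shows "ran (A_full w) = {A. closed A}"
proof
  show "ran (A_full w) \<subseteq> {A. closed A}"
    by (auto simp: ran_def A_full_eq_Some_iff A_plus_eq_Some_iff[OF assms])
  show "{A. closed A} \<subseteq> ran (A_full w)"
  proof clarify
    fix A :: "cantor set" assume "closed A"
    obtain p :: baire where p: "{n. Suc n \<in> range p} = {n. cylinder (w n) \<inter> A \<noteq> {}}"
      using ex_enumeration by blast
    obtain q :: baire where q: "{n. Suc n \<in> range q} = {n. cylinder (w n) \<subseteq> - A}"
      using ex_enumeration by blast
    define r where "r = (\<lambda>n. if even n then p (n div 2) else q (n div 2))"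
    have r: "(\<lambda>n. r (2 * n)) = p" "(\<lambda>n. r (2 * n + 1)) = q" by (auto simp: r_def)
    have "x \<in> (\<Union>n\<in>{n. cylinder (w n) \<subseteq> - A}. cylinder (w n))" if nA: "x \<notin> A" for x
    proof -
      obtain k where k: "cylinder (map x [0..<k]) \<subseteq> - A"
        using open_contains_cylinder[of "- A" x] \<open>closed A\<close> nA by (auto simp: open_Compl)
      obtain n where n: "w n = map x [0..<k]" using \<open>surj w\<close> by (metis surjD)
      have "x \<in> cylinder (w n)" by (simp add: n cylinder_def)
      with k show ?thesis unfolding n[symmetric] by blast
    qed
    then have "A_minus w q = Some A" unfolding A_minus_def q by blast
    then have "A_full w r = Some A"
      using p \<open>closed A\<close> unfolding A_full_eq_Some_iff A_plus_eq_Some_iff[OF assms] r by simp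
    then show "A \<in> ran (A_full w)" by (auto simp: ran_def)
  qed
qed

lemma ran_A_minus:
  assumes "surj w"
  shows "ran (A_minus w) = {A. closed A}"
proof
  show "ran (A_minus w) \<subseteq> {A. closed A}"
    by (auto simp: ran_def A_minus_def closed_Diff open_UN open_cylinder)
  show "{A. closed A} \<subseteq> ran (A_minus w)"
    unfolding ran_A_full[OF assms, symmetric] by (auto simp: ran_def A_full_eq_Some_iff)
qed

section \<open>The VC dimension\<close>

definition shattered :: "nat set \<Rightarrow> nat set set \<Rightarrow> bool" where
  "shattered A \<C> \<longleftrightarrow> card ((\<lambda>B. B \<inter> A) ` \<C>) = 2 ^ card A"

text \<open>The supremum over the empty set is 0, so the empty class has dimension 0.\<close>

definition vc_dim :: "nat set set \<Rightarrow> enat" where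
  "vc_dim \<C> = Sup {enat (card A) | A. finite A \<and> shattered A \<C>}"

lemma vc_dim_empty: "vc_dim {} = 0"
  by (simp add: vc_dim_def shattered_def bot_enat_def)

definition N_infinity :: "enat representation" where
  "N_infinity = named_by (\<lambda>p n. case n of
     enat k \<Rightarrow> (\<forall>i<k. p i = 0) \<and> p k = 1
   | \<infinity> \<Rightarrow> (\<forall>i. p i = 0))"

lemma N_infinity_eq_Some_enat_iff:
  "N_infinity p = Some (enat k) \<longleftrightarrow> (\<forall>i<k. p i = 0) \<and> p k = 1"
  and N_infinity_eq_Some_infinity_iff: "N_infinity p = Some \<infinity> \<longleftrightarrow> (\<forall>i. p i = 0)"
proof -
  have unique: "x = y"
    if "case x of enat k \<Rightarrow> (\<forall>i<k. p i = 0) \<and> p k = 1 | \<infinity> \<Rightarrow> (\<forall>i. p i = 0)"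
       "case y of enat k \<Rightarrow> (\<forall>i<k. p i = 0) \<and> p k = 1 | \<infinity> \<Rightarrow> (\<forall>i. p i = 0)" for x y
  proof (cases x; cases y)
    fix k l assume "x = enat k" "y = enat l"
    then show ?thesis using that by (cases k l rule: linorder_cases) auto
  qed (use that in auto)
  note * = named_by_eq_Some_iff[where R = "\<lambda>p n. case n of
     enat k \<Rightarrow> (\<forall>i<k. p i = 0) \<and> p k = 1 | \<infinity> \<Rightarrow> (\<forall>i. p i = 0)" and p = p, OF unique]
  show "N_infinity p = Some (enat k) \<longleftrightarrow> (\<forall>i<k. p i = 0) \<and> p k = 1"
    unfolding N_infinity_def using *[of "enat k"] by simp
  show "N_infinity p = Some \<infinity> \<longleftrightarrow> (\<forall>i. p i = 0)"
    unfolding N_infinity_def using *[of \<infinity>] by simp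
qed

text \<open>\<open>Collect\<close> identifies a point of Cantor space with a set of natural numbers.\<close>

definition VCdim :: "(nat \<Rightarrow> bool list) \<Rightarrow> (cantor set, enat) problem" where
  "VCdim w = single_valued_problem (A_full w) N_infinity (\<lambda>C. vc_dim (Collect ` C))"

definition VCdim_minus :: "(nat \<Rightarrow> bool list) \<Rightarrow> (cantor set, enat) problem" where
  "VCdim_minus w = single_valued_problem (A_minus w) N_infinity (\<lambda>C. vc_dim (Collect ` C))"

section \<open>Sorting\<close>

definition cantor_rep :: "cantor representation" where
  "cantor_rep p = (if range p \<subseteq> {0, 1} then Some (\<lambda>n. p n = 1) else None)"

definition sort_map :: "cantor \<Rightarrow> cantor" where
  "sort_map x = (if infinite {i. \<not> x i} then (\<lambda>_. False) else (\<lambda>j. card {i. \<not> x i} \<le> j))"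

definition SORT :: "(cantor, cantor) problem" where
  "SORT = single_valued_problem cantor_rep cantor_rep sort_map"

end

theory Submission
  imports Defs
begin

text \<open>
  The three problems form a cycle \<open>VCdim\<^sup>- \<le> VCdim' \<le> SORT' \<le> VCdim\<^sup>-\<close> of strong reductions.

  First, by compactness of Cantor space, disjointness of a cylinder from a closed set \<open>A\<close> is
  semidecidable from a negative name of \<open>A\<close>, so such a name yields a full name of \<open>A\<close> in the limit.

  Second, a positive name of \<open>A\<close> allows one to enumerate the numbers \<open>j\<close> such that \<open>A\<close> shatters a set of
  size \<open>j + 1\<close>. Writing one zero for each such \<open>j\<close> reduces \<open>VCdim\<close> to \<open>SORT\<close>; the reduction is total and
  continuous, so it commutes with limits.

  Third, let \<open>p\<^sub>0, p\<^sub>1, \<dots>\<close> converge to \<open>q\<close> and let \<open>G\<close> be the set of all pairs \<open>(n, s)\<close> such that \<open>s\<close> is the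
  first stage with \<open>p\<^sub>t(n) = 0\<close> for all \<open>t \<ge> s\<close>. Then \<open>G\<close> has as many elements as \<open>q\<close> has zeros, its
  complement is enumerable from the sequence, and the class of all subsets of \<open>G\<close> is closed of
  dimension \<open>|G|\<close>.
\<close>

section \<open>Oracle computations\<close>

text \<open>The program \<open>d\<close> is only known to work on one-element argument lists,
  whereas \<open>Oracle\<close> reads the head of any nonempty list; \<open>Proj 0\<close> bridges
  the difference.\<close>

primrec subst_oracle :: "prog \<Rightarrow> prog \<Rightarrow> prog" where
  "subst_oracle d Zero = Zero"
| "subst_oracle d Succ = Succ"
| "subst_oracle d (Proj i) = Proj i"
| "subst_oracle d Oracle = Comp d [Proj 0]"
| "subst_oracle d (Comp f gs) = Comp (subst_oracle d f) (map (subst_oracle d) gs)"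
| "subst_oracle d (PrimRec f g) = PrimRec (subst_oracle d f) (subst_oracle d g)"
| "subst_oracle d (Mu f) = Mu (subst_oracle d f)"

lemma eval_Comp1: "eval p g xs y \<Longrightarrow> eval p f [y] z \<Longrightarrow> eval p (Comp f [g]) xs z"
  by (rule eval.Comp[of "[y]"]) auto

lemma eval_subst_oracle:
  assumes "eval q c xs y" and d: "\<And>n. eval p d [n] (q n)"
  shows "eval p (subst_oracle d c) xs y"
  using assms(1)
proof induction
  case (Oracle x xs)
  have "eval p (Proj 0) (x # xs) x" using eval.Proj[of 0 "x # xs" p] by simp
  then show ?case using d by (auto intro: eval_Comp1)
next
  case (Comp ys gs xs f z)
  then show ?case by (auto intro!: eval.Comp[of ys])
qed (auto intro: eval.intros)

lemma computable_map_comp: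
  assumes "computable F" "computable G"
  shows "computable (F \<circ>\<^sub>m G)"
proof -
  obtain c where c: "\<And>p q n. F p = Some q \<Longrightarrow> eval p c [n] (q n)"
    using assms(1) unfolding computable_def by blast
  obtain d where d: "\<And>p q n. G p = Some q \<Longrightarrow> eval p d [n] (q n)"
    using assms(2) unfolding computable_def by blast
  have "eval p (subst_oracle d c) [n] (r n)" if "(F \<circ>\<^sub>m G) p = Some r" for p r n
    using that by (auto simp: map_comp_Some_iff intro: eval_subst_oracle c d)
  then show ?thesis unfolding computable_def by blast
qed

lemma sW_le_trans:
  assumes "f \<le>sW g" "g \<le>sW h"
  shows "f \<le>sW h"
proof -
  obtain H1 K1 where 1: "computable H1" "computable K1"
      "\<And>G. realizes G g \<Longrightarrow> realizes (H1 \<circ>\<^sub>m G \<circ>\<^sub>m K1) f"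
    using assms(1) unfolding sW_le_def by blast
  obtain H2 K2 where 2: "computable H2" "computable K2"
      "\<And>G. realizes G h \<Longrightarrow> realizes (H2 \<circ>\<^sub>m G \<circ>\<^sub>m K2) g"
    using assms(2) unfolding sW_le_def by blast
  have assoc: "H1 \<circ>\<^sub>m (H2 \<circ>\<^sub>m G \<circ>\<^sub>m K2) \<circ>\<^sub>m K1 = (H1 \<circ>\<^sub>m H2) \<circ>\<^sub>m G \<circ>\<^sub>m (K2 \<circ>\<^sub>m K1)" for G
    by (auto simp: fun_eq_iff map_comp_def split: option.splits)
  have "realizes ((H1 \<circ>\<^sub>m H2) \<circ>\<^sub>m G \<circ>\<^sub>m (K2 \<circ>\<^sub>m K1)) f" if "realizes G h" for G
    using 1(3)[OF 2(3)[OF that]] by (simp add: assoc)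
  then show ?thesis
    unfolding sW_le_def using computable_map_comp 1(1,2) 2(1,2) by blast
qed

text \<open>Use principle: a halting computation consults the oracle at finitely many places, so
  every oracle close enough to \<open>q\<close> yields the same run. In each case finitely many
  premises must hold simultaneously, also for \<open>Mu\<close>, where only the \<open>m < n\<close>
  matter.\<close>

lemma eval_eventually:
  assumes "eval q c xs y" and s: "s \<longlonglongrightarrow> q"
  shows "\<forall>\<^sub>F i in sequentially. eval (s i) c xs y"
  using assms(1)
proof induction
  case (Oracle x xs)
  have "\<forall>\<^sub>F i in sequentially. s i x = q x"
    using s unfolding LIMSEQ_baire_iff eventually_sequentially by blast
  then show ?case by eventually_elim (metis eval.Oracle)
next
  case (Comp ys gs xs f z)
  have "\<forall>\<^sub>F i in sequentially. \<forall>j\<in>{..<length gs}. eval (s i) (gs ! j) xs (ys ! j)"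
    using Comp.IH by (intro eventually_ball_finite) auto
  then show ?case using Comp.IH(2)
    by eventually_elim (auto intro: eval.Comp Comp.hyps)
next
  case (PrimRec_Suc f g n xs y z)
  from PrimRec_Suc.IH show ?case by eventually_elim (rule eval.PrimRec_Suc)
next
  case (Mu f n xs v)
  have "\<forall>\<^sub>F i in sequentially. \<forall>m\<in>{..<n}. eval (s i) f (m # xs) (Suc (v m))"
    using Mu.IH by (intro eventually_ball_finite) auto
  then show ?case using Mu.IH(1) by eventually_elim (auto intro: eval.Mu)
next
  case (PrimRec_0 f xs y g)
  from PrimRec_0.IH show ?case by eventually_elim (rule eval.PrimRec_0)
qed (auto intro: always_eventually eval.intros)

section \<open>Total computable functionals\<close>

text \<open>
  The second argument of a functional is an environment \<open>e\<close>, in which the value of the de Bruijn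
  variable \<open>i\<close> is \<open>e i\<close>; a program sees a sufficiently long finite prefix of it. With this
  encoding every rule below can be applied by higher-order pattern unification.
\<close>

definition comp_fun :: "(baire \<Rightarrow> (nat \<Rightarrow> nat) \<Rightarrow> nat) \<Rightarrow> bool" where
  "comp_fun f \<longleftrightarrow> (\<exists>c k. \<forall>p e n. k \<le> n \<longrightarrow> eval p c (map e [0..<n]) (f p e))"

definition comp_pred :: "(baire \<Rightarrow> (nat \<Rightarrow> nat) \<Rightarrow> bool) \<Rightarrow> bool" where
  "comp_pred P \<longleftrightarrow> comp_fun (\<lambda>p e. of_bool (P p e))"

named_theorems comp_intros

lemma map_case_nat_upt: "map (case_nat a e) [0..<Suc n] = a # map e [0..<n]"
  by (simp add: upt_conv_Cons map_Suc_upt[symmetric] del: upt_Suc)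

lemma comp_fun_var [comp_intros]: "comp_fun (\<lambda>p e. e i)"
  unfolding comp_fun_def
proof (intro exI allI impI)
  fix p :: baire and e :: "nat \<Rightarrow> nat" and n assume "Suc i \<le> n"
  then show "eval p (Proj i) (map e [0..<n]) (e i)"
    using eval.Proj[of i "map e [0..<n]" p] by simp
qed

text \<open>The program for \<open>F\<close> reads only its first \<open>k\<close> variables, so
  finitely many of the programs for \<open>a i\<close> are composed with it. The sum of their
  thresholds is a prefix length that serves all of them.\<close>

lemma comp_fun_subst:
  assumes "comp_fun F" and "\<And>i. comp_fun (a i)"
  shows "comp_fun (\<lambda>p e. F p (\<lambda>i. a i p e))"
proof -
  obtain c k where c: "\<And>p e n. k \<le> n \<Longrightarrow> eval p c (map e [0..<n]) (F p e)"
    using assms(1) unfolding comp_fun_def by blast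
  have "\<forall>i. \<exists>d l. \<forall>p e n. l \<le> n \<longrightarrow> eval p d (map e [0..<n]) (a i p e)"
    using assms(2) unfolding comp_fun_def by blast
  then obtain d l where d: "\<And>i p e n. l i \<le> n \<Longrightarrow> eval p (d i) (map e [0..<n]) (a i p e)"
    by metis
  have "eval p (Comp c (map d [0..<k])) (map e [0..<n]) (F p (\<lambda>i. a i p e))"
    if n: "(\<Sum>i<k. l i) \<le> n" for p e n
  proof (rule eval.Comp)
    show "eval p c (map (\<lambda>i. a i p e) [0..<k]) (F p (\<lambda>i. a i p e))" using c by simp
    fix i assume "i < length (map d [0..<k])"
    then have "i < k" by simp
    moreover have "l i \<le> n" using member_le_sum[of i "{..<k}" l] \<open>i < k\<close> n by simp
    ultimately show "eval p (map d [0..<k] ! i) (map e [0..<n]) (map (\<lambda>i. a i p e) [0..<k] ! i)"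
      using d by simp
  qed simp
  then show ?thesis unfolding comp_fun_def by blast
qed

text \<open>Renaming of variables. With \<open>h = Suc\<close> it carries a functional under a
  binder.\<close>

lemma comp_fun_shift:
  assumes "comp_fun f"
  shows "comp_fun (\<lambda>p e. f p (\<lambda>i. e (h i)))"
  by (rule comp_fun_subst[OF assms, where a = "\<lambda>i p e. e (h i)"]) (rule comp_fun_var)

text \<open>The argument is first treated as a fresh variable 0, for which \<open>a\<close> is then
  substituted.\<close>

lemma comp_fun_apply:
  assumes "comp_fun (\<lambda>p e. G p (\<lambda>i. e (Suc i)) (e 0))" and "comp_fun a"
  shows "comp_fun (\<lambda>p e. G p e (a p e))"
proof -
  have "comp_fun (case i of 0 \<Rightarrow> a | Suc j \<Rightarrow> (\<lambda>p e. e j))" for i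
    using assms(2) by (auto intro: comp_fun_var split: nat.split)
  from comp_fun_subst[OF assms(1),
      where a = "\<lambda>i. case i of 0 \<Rightarrow> a | Suc j \<Rightarrow> (\<lambda>p e. e j)", OF this]
  show ?thesis by simp
qed

section \<open>Recursion, oracle calls and unbounded search\<close>

text \<open>After reduction to recursion along variable 0, the argument order is that of
  \<open>PrimRec\<close>: in the step, variable 0 is the counter, variable 1 the previous value, and
  the parameters follow.\<close>

lemma comp_fun_rec_nat [comp_intros]:
  assumes "comp_fun a" and "comp_fun (\<lambda>p e. G p (\<lambda>i. e (Suc (Suc i))) (e 0) (e (Suc 0)))"
    and "comp_fun b"
  shows "comp_fun (\<lambda>p e. rec_nat (a p e) (\<lambda>m y. G p e m y) (b p e))"
proof (rule comp_fun_apply[OF _ assms(3)])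
  obtain c k where c: "\<And>p e n. k \<le> n \<Longrightarrow> eval p c (map e [0..<n]) (a p e)"
    using assms(1) unfolding comp_fun_def by blast
  obtain d l where d: "\<And>p e n. l \<le> n \<Longrightarrow>
      eval p d (map e [0..<n]) (G p (\<lambda>i. e (Suc (Suc i))) (e 0) (e (Suc 0)))"
    using assms(2) unfolding comp_fun_def by blast
  have *: "eval p (PrimRec c d) (m # map e [0..<n]) (rec_nat (a p e) (\<lambda>m y. G p e m y) m)"
    if n: "k + l \<le> n" for p e m n
  proof (induction m)
    case 0
    then show ?case using c n by (auto intro!: eval.PrimRec_0)
  next
    case (Suc m)
    define y where "y = rec_nat (a p e) (\<lambda>m y. G p e m y) m"
    have "eval p d (m # y # map e [0..<n]) (G p e m y)"
      using d[where e = "case_nat m (case_nat y e)" and n = "Suc (Suc n)"] n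
      by (simp add: map_case_nat_upt del: upt_Suc)
    then show ?case using Suc.IH by (auto intro!: eval.PrimRec_Suc simp: y_def)
  qed
  show "comp_fun (\<lambda>p e. rec_nat (a p (\<lambda>i. e (Suc i))) (\<lambda>m y. G p (\<lambda>i. e (Suc i)) m y) (e 0))"
    unfolding comp_fun_def
  proof (intro exI[of _ "PrimRec c d"] exI[of _ "Suc (k + l)"] allI impI)
    fix p :: baire and e :: "nat \<Rightarrow> nat" and n assume "Suc (k + l) \<le> n"
    then obtain n' where n': "n = Suc n'" "k + l \<le> n'" by (cases n) auto
    have "map e [0..<n] = e 0 # map (\<lambda>i. e (Suc i)) [0..<n']"
      unfolding n' by (simp add: upt_conv_Cons map_Suc_upt[symmetric] del: upt_Suc)
    then show "eval p (PrimRec c d) (map e [0..<n])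
        (rec_nat (a p (\<lambda>i. e (Suc i))) (\<lambda>m y. G p (\<lambda>i. e (Suc i)) m y) (e 0))"
      using *[OF n'(2)] by simp
  qed
qed

lemma comp_fun_0: "comp_fun (\<lambda>p e. 0)"
  unfolding comp_fun_def by (blast intro: eval.Zero)

lemma comp_fun_Suc [comp_intros]: "comp_fun f \<Longrightarrow> comp_fun (\<lambda>p e. Suc (f p e))"
  unfolding comp_fun_def by (blast intro: eval_Comp1 eval.Succ)

lemma comp_fun_const [comp_intros]: "comp_fun (\<lambda>p e. m)"
  by (induction m) (auto intro: comp_fun_0 comp_fun_Suc)

lemma comp_fun_oracle [comp_intros]: "comp_fun f \<Longrightarrow> comp_fun (\<lambda>p e. p (f p e))"
  unfolding comp_fun_def by (blast intro: eval_Comp1 eval.Oracle)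

lemma comp_fun_Least [comp_intros]:
  assumes "comp_pred (\<lambda>p e. P p (\<lambda>i. e (Suc i)) (e 0))" and ex: "\<And>p e. \<exists>m. P p e m"
  shows "comp_fun (\<lambda>p e. LEAST m. P p e m)"
proof -
  \<comment> \<open>\<open>Mu\<close> stops at the value 0, so the complemented truth value is
    needed; this recursion exchanges 0 and 1.\<close>
  have "comp_fun (\<lambda>p e. rec_nat 1 (\<lambda>_ _. 0) (of_bool (P p (\<lambda>i. e (Suc i)) (e 0))))"
    using assms(1) unfolding comp_pred_def by (intro comp_intros)
  moreover have "rec_nat 1 (\<lambda>_ _. 0) (of_bool Q) = (of_bool (\<not> Q) :: nat)" for Q
    by (cases Q) auto
  ultimately have "comp_fun (\<lambda>p e. of_bool (\<not> P p (\<lambda>i. e (Suc i)) (e 0)))" by simp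
  then obtain c k where c: "\<And>p e n. k \<le> n \<Longrightarrow>
      eval p c (map e [0..<n]) (of_bool (\<not> P p (\<lambda>i. e (Suc i)) (e 0)))"
    unfolding comp_fun_def by blast
  have c': "eval p c (m # map e [0..<n]) (of_bool (\<not> P p e m))" if "k \<le> n" for p e m n
    using c[where e = "case_nat m e" and n = "Suc n"] that
    by (simp add: map_case_nat_upt del: upt_Suc)
  have "eval p (Mu c) (map e [0..<n]) (LEAST m. P p e m)" if "k \<le> n" for p e n
  proof (rule eval.Mu[where v = "\<lambda>_. 0"])
    show "eval p c ((LEAST m. P p e m) # map e [0..<n]) 0"
      using c'[OF that, of p "LEAST m. P p e m" e] LeastI_ex[OF ex[of p e]] by simp
    show "eval p c (m # map e [0..<n]) (Suc 0)" if "m < (LEAST m. P p e m)" for m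
      using c'[OF \<open>k \<le> n\<close>, of p m e] not_less_Least[OF that] by simp
  qed
  then show ?thesis unfolding comp_fun_def by blast
qed

section \<open>Arithmetic, decidable predicates and bounded quantifiers\<close>

lemma comp_fun_add [comp_intros]:
  assumes "comp_fun f" "comp_fun g"
  shows "comp_fun (\<lambda>p e. f p e + g p e)"
proof -
  have "rec_nat a (\<lambda>_ y. Suc y) b = a + b" for a b :: nat by (induction b) auto
  moreover have "comp_fun (\<lambda>p e. rec_nat (f p e) (\<lambda>_ y. Suc y) (g p e))"
    by (intro comp_intros assms)
  ultimately show ?thesis by simp
qed

lemma comp_fun_mult [comp_intros]:
  assumes "comp_fun f" "comp_fun g"
  shows "comp_fun (\<lambda>p e. f p e * g p e)"
proof -
  have "rec_nat 0 (\<lambda>_ y. y + a) b = a * b" for a b :: nat by (induction b) auto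
  moreover have "comp_fun (\<lambda>p e. rec_nat 0 (\<lambda>_ y. y + f p e) (g p e))"
    by (intro comp_intros comp_fun_shift[OF assms(1)] assms(2))
  ultimately show ?thesis by simp
qed

lemma comp_fun_power [comp_intros]:
  assumes "comp_fun f" "comp_fun g"
  shows "comp_fun (\<lambda>p e. f p e ^ g p e)"
proof -
  have "rec_nat (Suc 0) (\<lambda>_ y. y * a) b = a ^ b" for a b :: nat by (induction b) auto
  moreover have "comp_fun (\<lambda>p e. rec_nat (Suc 0) (\<lambda>_ y. y * f p e) (g p e))"
    by (intro comp_intros comp_fun_shift[OF assms(1)] assms(2))
  ultimately show ?thesis by simp
qed

lemma comp_fun_diff [comp_intros]:
  assumes "comp_fun f" "comp_fun g"
  shows "comp_fun (\<lambda>p e. f p e - g p e)"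
proof -
  \<comment> \<open>This recursion is the predecessor; iterating it gives truncated
    subtraction.\<close>
  have 1: "rec_nat 0 (\<lambda>m _. m) a = a - Suc 0" for a by (cases a) auto
  have 2: "rec_nat a (\<lambda>_ y. y - Suc 0) b = a - b" for a b by (induction b) auto
  have "comp_fun (\<lambda>p e. rec_nat (f p e) (\<lambda>_ y. rec_nat 0 (\<lambda>m _. m) y) (g p e))"
    by (intro comp_intros assms)
  then show ?thesis by (simp add: 1 2)
qed

lemma comp_pred_less [comp_intros]:
  assumes "comp_fun f" "comp_fun g"
  shows "comp_pred (\<lambda>p e. f p e < g p e)"
proof -
  have "(of_bool (a < b) :: nat) = 1 - (1 - (b - a))" for a b :: nat by auto
  moreover have "comp_fun (\<lambda>p e. 1 - (1 - (g p e - f p e)))" by (intro comp_intros assms)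
  ultimately show ?thesis unfolding comp_pred_def by simp
qed

lemma comp_pred_not [comp_intros]:
  assumes "comp_pred P"
  shows "comp_pred (\<lambda>p e. \<not> P p e)"
proof -
  have "(of_bool (\<not> Q) :: nat) = 1 - of_bool Q" for Q by auto
  moreover have "comp_fun (\<lambda>p e. 1 - of_bool (P p e))"
    by (intro comp_intros assms[unfolded comp_pred_def])
  ultimately show ?thesis unfolding comp_pred_def by simp
qed

lemma comp_pred_conj [comp_intros]:
  assumes "comp_pred P" "comp_pred Q"
  shows "comp_pred (\<lambda>p e. P p e \<and> Q p e)"
  using comp_fun_mult[OF assms[unfolded comp_pred_def]]
  unfolding comp_pred_def of_bool_conj .

lemma comp_pred_disj [comp_intros]:
  "comp_pred P \<Longrightarrow> comp_pred Q \<Longrightarrow> comp_pred (\<lambda>p e. P p e \<or> Q p e)"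
  using comp_pred_not[OF comp_pred_conj[OF comp_pred_not comp_pred_not]] by simp

lemma comp_pred_imp [comp_intros]:
  "comp_pred P \<Longrightarrow> comp_pred Q \<Longrightarrow> comp_pred (\<lambda>p e. P p e \<longrightarrow> Q p e)"
  unfolding imp_conv_disj by (intro comp_intros)

lemma comp_pred_iff [comp_intros]:
  "comp_pred P \<Longrightarrow> comp_pred Q \<Longrightarrow> comp_pred (\<lambda>p e. P p e \<longleftrightarrow> Q p e)"
  unfolding iff_conv_conj_imp by (intro comp_intros)

lemma comp_pred_le [comp_intros]:
  "comp_fun f \<Longrightarrow> comp_fun g \<Longrightarrow> comp_pred (\<lambda>p e. f p e \<le> g p e)"
  unfolding not_less[symmetric] by (intro comp_intros)

lemma comp_pred_eq [comp_intros]: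
  "comp_fun f \<Longrightarrow> comp_fun g \<Longrightarrow> comp_pred (\<lambda>p e. f p e = g p e)"
  unfolding eq_iff by (intro comp_intros)

lemma comp_fun_if [comp_intros]:
  assumes "comp_pred P" "comp_fun f" "comp_fun g"
  shows "comp_fun (\<lambda>p e. if P p e then f p e else g p e)"
proof -
  have "(if Q then a else b) = of_bool Q * a + (1 - of_bool Q) * b" for Q and a b :: nat
    by auto
  moreover have "comp_fun (\<lambda>p e. of_bool (P p e) * f p e + (1 - of_bool (P p e)) * g p e)"
    by (intro comp_intros assms assms(1)[unfolded comp_pred_def])
  ultimately show ?thesis by simp
qed

lemma comp_fun_sum [comp_intros]:
  assumes "comp_fun (\<lambda>p e. G p (\<lambda>i. e (Suc i)) (e 0))" "comp_fun b"
  shows "comp_fun (\<lambda>p e. \<Sum>i<b p e. G p e i)"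
proof -
  have "rec_nat 0 (\<lambda>i y. y + g i) n = (\<Sum>i<n. g i)" for g :: "nat \<Rightarrow> nat" and n
    by (induction n) auto
  \<comment> \<open>The recursion step binds the counter and the running sum, while \<open>G\<close>
    knows only the counter; the renaming skips variable 1.\<close>
  moreover have "comp_fun (\<lambda>p e. G p (\<lambda>i. e (Suc (Suc i))) (e 0))"
    using comp_fun_shift[OF assms(1), of "case_nat 0 (\<lambda>i. Suc (Suc i))"] by simp
  then have "comp_fun (\<lambda>p e. rec_nat 0 (\<lambda>i y. y + G p e i) (b p e))"
    by (intro comp_intros assms(2))
  ultimately show ?thesis by simp
qed

lemma comp_pred_all [comp_intros]:
  assumes "comp_pred (\<lambda>p e. P p (\<lambda>i. e (Suc i)) (e 0))" "comp_fun b"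
  shows "comp_pred (\<lambda>p e. \<forall>i<b p e. P p e i)"
proof -
  have "(\<forall>i<n. Q i) \<longleftrightarrow> (\<Sum>i<n. of_bool (\<not> Q i)) = (0::nat)" for Q and n :: nat
    by (auto simp: of_bool_def)
  moreover have "comp_pred (\<lambda>p e. (\<Sum>i<b p e. of_bool (\<not> P p e i)) = (0::nat))"
    by (intro comp_intros comp_pred_not[unfolded comp_pred_def] assms
        assms(1)[unfolded comp_pred_def])
  ultimately show ?thesis by simp
qed

lemma comp_pred_ex [comp_intros]:
  assumes "comp_pred (\<lambda>p e. P p (\<lambda>i. e (Suc i)) (e 0))" "comp_fun b"
  shows "comp_pred (\<lambda>p e. \<exists>i<b p e. P p e i)"
proof -
  have "comp_pred (\<lambda>p e. \<not> (\<forall>i<b p e. \<not> P p e i))" by (intro comp_intros assms)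
  then show ?thesis by simp
qed

lemma comp_fun_div [comp_intros]:
  assumes "comp_fun f" "comp_fun g"
  shows "comp_fun (\<lambda>p e. f p e div g p e)"
proof -
  \<comment> \<open>The disjunct \<open>b = 0\<close> makes the search total and produces the
    convention \<open>a div 0 = 0\<close>.\<close>
  have *: "a div b = (LEAST q. b = 0 \<or> a < Suc q * b)" for a b :: nat
  proof (cases "b = 0")
    case False
    then have "a < Suc q * b \<longleftrightarrow> a div b \<le> q" for q
      by (simp add: less_Suc_eq_le[symmetric] div_less_iff_less_mult del: mult_Suc)
    then have "(LEAST q. a < Suc q * b) = a div b" by (auto intro: Least_equality)
    with False show ?thesis by simp
  qed simp
  have "comp_fun (\<lambda>p e. LEAST q. g p e = 0 \<or> f p e < Suc q * g p e)"
  proof (intro comp_intros comp_fun_shift[OF assms(1)] comp_fun_shift[OF assms(2)])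
    show "\<exists>m. g p e = 0 \<or> f p e < Suc m * g p e" for p e
      using mult_le_mono2[of 1 "g p e" "Suc (f p e)"]
      by (cases "g p e = 0") (auto intro!: exI[of _ "f p e"])
  qed
  then show ?thesis by (simp add: *)
qed

lemma comp_fun_mod [comp_intros]:
  "comp_fun f \<Longrightarrow> comp_fun g \<Longrightarrow> comp_fun (\<lambda>p e. f p e mod g p e)"
  unfolding modulo_nat_def by (intro comp_intros)

lemma comp_pred_even [comp_intros]: "comp_fun f \<Longrightarrow> comp_pred (\<lambda>p e. even (f p e))"
  unfolding even_iff_mod_2_eq_zero by (intro comp_intros)

lemma comp_fun_prod_encode [comp_intros]:
  "comp_fun f \<Longrightarrow> comp_fun g \<Longrightarrow> comp_fun (\<lambda>p e. prod_encode (f p e, g p e))"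
  unfolding prod_encode_def triangle_def prod.case by (intro comp_intros)

text \<open>The components of a pair do not exceed its code, so one is found by search and the other
  by a bounded quantifier.\<close>

lemma comp_fun_prod_decode [comp_intros]:
  assumes "comp_fun f"
  shows "comp_fun (\<lambda>p e. fst (prod_decode (f p e)))" "comp_fun (\<lambda>p e. snd (prod_decode (f p e)))"
proof -
  have ex: "\<exists>b<Suc n. prod_encode (fst (prod_decode n), b) = n"
    "\<exists>a<Suc n. prod_encode (a, snd (prod_decode n)) = n" for n
    using le_prod_encode_1[of "fst (prod_decode n)" "snd (prod_decode n)"]
      le_prod_encode_2[of "snd (prod_decode n)" "fst (prod_decode n)"]
    by (metis less_Suc_eq_le prod.collapse prod_decode_inverse)+
  have 1: "fst (prod_decode n) = (LEAST a. \<exists>b<Suc n. prod_encode (a, b) = n)" for n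
    by (rule Least_equality[symmetric]) (use ex in auto)
  have 2: "snd (prod_decode n) = (LEAST b. \<exists>a<Suc n. prod_encode (a, b) = n)" for n
    by (rule Least_equality[symmetric]) (use ex in auto)
  show "comp_fun (\<lambda>p e. fst (prod_decode (f p e)))" unfolding 1
    by (intro comp_intros comp_fun_shift[OF assms]) (use ex in blast)
  show "comp_fun (\<lambda>p e. snd (prod_decode (f p e)))" unfolding 2
    by (intro comp_intros comp_fun_shift[OF assms]) (use ex in blast)
qed

section \<open>Computable maps on Baire space and strong reductions\<close>

lemma computable_Some_iff: "computable (\<lambda>p. Some (f p)) \<longleftrightarrow> (\<exists>c. \<forall>p n. eval p c [n] (f p n))"
  by (auto simp: computable_def)

lemma computable_if_comp_fun:
  assumes "comp_fun (\<lambda>p e. f p (e 0))"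
  shows "computable (\<lambda>p. Some (f p))"
proof -
  obtain c k where c: "\<And>p e n. k \<le> n \<Longrightarrow> eval p c (map e [0..<n]) (f p (e 0))"
    using assms unfolding comp_fun_def by blast
  \<comment> \<open>The only actual argument is \<open>n\<close>. Zeros fill the environment up to a
    length that \<open>c\<close> accepts; the value does not depend on them.\<close>
  have "eval p (Comp c (Proj 0 # replicate k Zero)) [n] (f p n)" for p n
  proof (rule eval.Comp)
    have "map (case_nat n (\<lambda>_. 0)) [0..<Suc k] = n # replicate k 0"
      by (simp add: map_case_nat_upt map_replicate_const del: upt_Suc)
    then show "eval p c (n # replicate k 0) (f p n)"
      using c[of "Suc k" p "case_nat n (\<lambda>_. 0)"] by (simp del: upt_Suc)
    fix i assume "i < length (Proj 0 # replicate k Zero)"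
    then show "eval p ((Proj 0 # replicate k Zero) ! i) [n] ((n # replicate k 0) ! i)"
      using eval.Proj[of 0 "[n]" p] by (cases i) (auto intro: eval.Zero)
  qed simp
  then show ?thesis unfolding computable_Some_iff by blast
qed

lemma comp_fun_if_computable:
  assumes "computable (\<lambda>p. Some (f p))" "comp_fun a"
  shows "comp_fun (\<lambda>p e. f p (a p e))"
  using assms unfolding computable_Some_iff comp_fun_def by (blast intro: eval_Comp1)

text \<open>Computable functionals are continuous: determinism turns the eventual halting with value
  \<open>f q n\<close> into eventual equality of values.\<close>

lemma computable_imp_tendsto:
  assumes "computable (\<lambda>p. Some (f p))" "s \<longlonglongrightarrow> q"
  shows "(\<lambda>i. f (s i)) \<longlonglongrightarrow> f q"
  unfolding LIMSEQ_baire_iff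
proof
  fix n
  obtain c where c: "\<And>p n. eval p c [n] (f p n)"
    using assms(1) unfolding computable_Some_iff by blast
  have "\<forall>\<^sub>F i in sequentially. eval (s i) c [n] (f q n)"
    by (rule eval_eventually[OF c assms(2)])
  then have "\<forall>\<^sub>F i in sequentially. f (s i) n = f q n"
    by eventually_elim (rule eval_deterministic[OF c])
  then show "\<exists>N. \<forall>i\<ge>N. f (s i) n = f q n" unfolding eventually_sequentially .
qed

text \<open>Eliminates realizers: an arbitrary realizer of \<open>G\<close> enters only through one
  name \<open>q\<close> of a correct answer.\<close>

lemma sW_leI:
  assumes "computable (\<lambda>p. Some (k p))" "computable (\<lambda>q. Some (h q))"
    and "\<And>p x. in_rep F p = Some x \<Longrightarrow> \<exists>x'. in_rep G (k p) = Some x' \<and> mv G x' \<noteq> {} \<and>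
      (\<forall>q y. out_rep G q = Some y \<and> y \<in> mv G x' \<longrightarrow> (\<exists>z\<in>mv F x. out_rep F (h q) = Some z))"
  shows "F \<le>sW G"
  unfolding sW_le_def
proof (intro exI conjI allI impI)
  fix R assume R: "realizes R G"
  show "realizes ((\<lambda>q. Some (h q)) \<circ>\<^sub>m R \<circ>\<^sub>m (\<lambda>p. Some (k p))) F"
    unfolding realizes_def
  proof (intro allI impI)
    fix p x assume "in_rep F p = Some x \<and> mv F x \<noteq> {}"
    then obtain x' where x': "in_rep G (k p) = Some x'" "mv G x' \<noteq> {}"
      "\<forall>q y. out_rep G q = Some y \<and> y \<in> mv G x' \<longrightarrow> (\<exists>z\<in>mv F x. out_rep F (h q) = Some z)"
      using assms(3) by blast
    obtain q y where q: "R (k p) = Some q" "out_rep G q = Some y" "y \<in> mv G x'"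
      using R x'(1,2) unfolding realizes_def by blast
    then obtain z where "z \<in> mv F x" "out_rep F (h q) = Some z" using x'(3) by blast
    then show "\<exists>q y. ((\<lambda>q. Some (h q)) \<circ>\<^sub>m R \<circ>\<^sub>m (\<lambda>p. Some (k p))) p = Some q \<and>
        out_rep F q = Some y \<and> y \<in> mv F x"
      using q(1) by (auto simp: map_comp_def)
  qed
qed (use assms in auto)

section \<open>Binary words\<close>

text \<open>Words are read as finite partial functions, accessed only through this predicate and
  \<open>has_one\<close>; both are decidable for a computable enumeration.\<close>

definition in_dom :: "(nat \<Rightarrow> bool list) \<Rightarrow> nat \<Rightarrow> nat \<Rightarrow> bool" where
  "in_dom w n i \<longleftrightarrow> i < length (w n)"

definition has_one :: "(nat \<Rightarrow> bool list) \<Rightarrow> nat \<Rightarrow> nat \<Rightarrow> bool" where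
  "has_one w n i \<longleftrightarrow> i < length (w n) \<and> w n ! i"

lemma mem_cylinder_iff:
  "x \<in> cylinder (w n) \<longleftrightarrow> (\<forall>i. in_dom w n i \<longrightarrow> (has_one w n i \<longleftrightarrow> x i))"
  by (auto simp: cylinder_def in_dom_def has_one_def)

text \<open>A nonempty list is coded by the successor of the pair of its head and the code of its
  tail, so each step removes the head. The code 0 of the empty list is a fixed point because
  \<open>prod_decode 0 = (0, 0)\<close>.\<close>

lemma rec_nat_list_encode_drop:
  "rec_nat (list_encode l) (\<lambda>_ y. snd (prod_decode (y - Suc 0))) i = list_encode (drop i l)"
proof (induction i)
  case (Suc i)
  have "prod_decode 0 = (0, 0)"
    using prod_encode_inverse[of "(0, 0)"] by (simp add: prod_encode_def)
  then have "snd (prod_decode (list_encode l - Suc 0)) = list_encode (tl l)" for l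
    by (cases l) auto
  with Suc show ?case by (simp add: drop_Suc drop_tl)
qed simp

context
  fixes w :: "nat \<Rightarrow> bool list"
  assumes w: "computable_enumeration w"
begin

lemma comp_fun_word_drop:
  assumes "comp_fun f" "comp_fun g"
  shows "comp_fun (\<lambda>p e. list_encode (drop (g p e) (map of_bool (w (f p e)))))"
proof -
  have "computable (\<lambda>_. Some (\<lambda>n. list_encode (map of_bool (w n))))"
    using w unfolding computable_enumeration_def computable_seq_def of_bool_def[abs_def] .
  then have "comp_fun (\<lambda>p e. list_encode (map of_bool (w (f p e))))"
    using assms(1) by (rule comp_fun_if_computable)
  then show ?thesis
    unfolding rec_nat_list_encode_drop[symmetric] by (intro comp_intros assms(2))
qed

lemma comp_pred_in_dom:
  assumes "comp_fun f" "comp_fun g"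
  shows "comp_pred (\<lambda>p e. in_dom w (f p e) (g p e))"
proof -
  have *: "in_dom w n i \<longleftrightarrow> 0 < list_encode (drop i (map of_bool (w n)))" for n i
    by (cases "i < length (w n)") (auto simp: in_dom_def Cons_nth_drop_Suc[symmetric])
  show ?thesis unfolding * by (intro comp_intros comp_fun_word_drop assms)
qed

lemma comp_pred_has_one:
  assumes "comp_fun f" "comp_fun g"
  shows "comp_pred (\<lambda>p e. has_one w (f p e) (g p e))"
proof -
  have *: "has_one w n i \<longleftrightarrow> in_dom w n i \<and>
      fst (prod_decode (list_encode (drop i (map of_bool (w n))) - 1)) = 1" for n i
    by (cases "i < length (w n)")
      (auto simp: in_dom_def has_one_def Cons_nth_drop_Suc[symmetric])
  show ?thesis unfolding *
    by (intro comp_intros comp_fun_word_drop comp_pred_in_dom assms)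
qed

end

text \<open>Allows a bounded quantifier over numbers to replace quantification over all bit patterns
  of length \<open>N\<close>.\<close>

lemma ex_nat_bits: "\<exists>b<2 ^ N. \<forall>i<N. odd (b div 2 ^ i :: nat) \<longleftrightarrow> x i"
proof (induction N)
  case (Suc N)
  then obtain b :: nat where b: "b < 2 ^ N" "\<forall>i<N. odd (b div 2 ^ i) \<longleftrightarrow> x i" by blast
  define c where "c = b + of_bool (x N) * 2 ^ N"
  have "odd (c div 2 ^ i) \<longleftrightarrow> x i" if "i < Suc N" for i
  proof (cases "i = N")
    case True
    then show ?thesis using b(1) by (simp add: c_def)
  next
    case False
    then obtain d where d: "N = i + Suc d" using \<open>i < Suc N\<close>
      by (metis less_SucE less_imp_Suc_add add_Suc_right)
    \<comment> \<open>For \<open>i < N\<close> the added top bit remains an even contribution after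
      division by \<open>2 ^ i\<close>, so bit \<open>i\<close> of \<open>b\<close> is
      unchanged.\<close>
    have "c = b + 2 ^ i * (2 * (of_bool (x N) * 2 ^ d))" by (simp add: c_def d power_add)
    then have "c div 2 ^ i = 2 * (of_bool (x N) * 2 ^ d) + b div 2 ^ i" by simp
    then show ?thesis using b(2) d by simp
  qed
  moreover have "c < 2 ^ Suc N" using b(1) by (simp add: c_def)
  ultimately show ?case by blast
qed simp

lemma compact_cylinder: "compact (cylinder u)"
proof -
  have "compactin (product_topology (\<lambda>_. euclidean) UNIV)
      (PiE UNIV (\<lambda>i. if i < length u then {u ! i} else UNIV))"
    by (auto simp: compactin_PiE intro: finite_imp_compact)
  then show ?thesis by (simp add: cylinder_eq_PiE euclidean_product_topology)
qed

section \<open>From negative information to full information in the limit\<close>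

text \<open>The lowest \<open>s\<close> bits of \<open>b\<close> spell a word of length
  \<open>s\<close>, of which \<open>w n\<close> has to be a prefix; the first conjunct bounds the
  length of \<open>w n\<close> by \<open>s\<close>.\<close>

definition matches :: "(nat \<Rightarrow> bool list) \<Rightarrow> nat \<Rightarrow> nat \<Rightarrow> nat \<Rightarrow> bool" where
  "matches w n b s \<longleftrightarrow>
     \<not> in_dom w n s \<and> (\<forall>i<s. in_dom w n i \<longrightarrow> (has_one w n i \<longleftrightarrow> odd (b div 2 ^ i)))"

text \<open>A decidable stage of the covering test: every word of length \<open>s\<close> extending
  \<open>w n\<close> extends a word that \<open>p\<close> lists before position \<open>s\<close>.
  The value 0 lists nothing, and \<open>p m - 1\<close> undoes the shift by one.\<close>

definition covered :: "(nat \<Rightarrow> bool list) \<Rightarrow> baire \<Rightarrow> nat \<Rightarrow> nat \<Rightarrow> bool" where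
  "covered w p n s \<longleftrightarrow> \<not> in_dom w n s \<and>
     (\<forall>b<2 ^ s. matches w n b s \<longrightarrow> (\<exists>m<s. 0 < p m \<and> matches w (p m - 1) b s))"

lemma comp_pred_covered:
  assumes "computable_enumeration w" "comp_fun f" "comp_fun g"
  shows "comp_pred (\<lambda>p e. covered w p (f p e) (g p e))"
  unfolding covered_def matches_def
  by (intro comp_intros comp_pred_in_dom comp_pred_has_one assms(1)
      comp_fun_shift[OF assms(2)] comp_fun_shift[OF assms(3)])

lemma matches_iff:
  assumes "\<forall>i<s. odd (b div 2 ^ i) \<longleftrightarrow> x i"
  shows "matches w n b s \<longleftrightarrow> \<not> in_dom w n s \<and> x \<in> cylinder (w n)"
  using assms unfolding matches_def mem_cylinder_iff
  by (auto simp: in_dom_def has_one_def)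

text \<open>For words of length at most \<open>s\<close>, membership in their cylinders depends only
  on the first \<open>s\<close> bits of a point, and some \<open>b < 2 ^ s\<close> has these
  bits.\<close>

lemma covered_imp_subset:
  assumes "covered w p n s"
  shows "cylinder (w n) \<subseteq> (\<Union>k\<in>{k. Suc k \<in> range p}. cylinder (w k))"
proof
  fix x assume x: "x \<in> cylinder (w n)"
  obtain b :: nat where b: "b < 2 ^ s" "\<forall>i<s. odd (b div 2 ^ i) \<longleftrightarrow> x i"
    using ex_nat_bits by blast
  have "matches w n b s"
    using assms x unfolding covered_def by (simp add: matches_iff[OF b(2)])
  then obtain m where "0 < p m" "matches w (p m - 1) b s"
    using assms b(1) unfolding covered_def by blast
  then have "Suc (p m - 1) \<in> range p" "x \<in> cylinder (w (p m - 1))"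
    unfolding matches_iff[OF b(2)] by auto
  then show "x \<in> (\<Union>k\<in>{k. Suc k \<in> range p}. cylinder (w k))" by blast
qed

text \<open>By compactness finitely many listed cylinders suffice; the test succeeds as soon as
  \<open>s\<close> exceeds their positions in \<open>p\<close> and is at least the lengths of all
  words involved.\<close>

lemma eventually_covered:
  assumes "cylinder (w n) \<subseteq> (\<Union>k\<in>{k. Suc k \<in> range p}. cylinder (w k))"
  shows "\<exists>S. \<forall>s\<ge>S. covered w p n s"
proof -
  have "cylinder (w n) \<subseteq> (\<Union>m\<in>{m. 0 < p m}. cylinder (w (p m - 1)))"
  proof
    fix x assume "x \<in> cylinder (w n)"
    then obtain k m where "Suc k = p m" "x \<in> cylinder (w k)" using assms by blast
    then show "x \<in> (\<Union>m\<in>{m. 0 < p m}. cylinder (w (p m - 1)))"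
      by (auto intro!: exI[of _ m] simp flip: \<open>Suc k = p m\<close>)
  qed
  then obtain M where M: "M \<subseteq> {m. 0 < p m}" "finite M"
      "cylinder (w n) \<subseteq> (\<Union>m\<in>M. cylinder (w (p m - 1)))"
    by (rule compactE_image[OF compact_cylinder open_cylinder])
  \<comment> \<open>A sum dominates each of its terms; \<open>Suc m\<close> makes every position in
    \<open>M\<close> strictly smaller than \<open>S\<close>.\<close>
  define S where "S = length (w n) + (\<Sum>m\<in>M. Suc m + length (w (p m - 1)))"
  have S: "m < S" "length (w (p m - 1)) \<le> S" if "m \<in> M" for m
    using member_le_sum[OF that, of "\<lambda>m. Suc m + length (w (p m - 1))"] M(2)
    by (auto simp: S_def)
  have "covered w p n s" if s: "S \<le> s" for s
    unfolding covered_def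
  proof (intro conjI allI impI)
    show "\<not> in_dom w n s" using s by (simp add: in_dom_def S_def)
    fix b :: nat assume "matches w n b s"
    define x where "x = (\<lambda>i. odd (b div 2 ^ i))"
    have x: "\<forall>i<s. odd (b div 2 ^ i) \<longleftrightarrow> x i" by (simp add: x_def)
    obtain m where m: "m \<in> M" "x \<in> cylinder (w (p m - 1))"
      using \<open>matches w n b s\<close> M(3) unfolding matches_iff[OF x] by blast
    then have "matches w (p m - 1) b s"
      using S(2)[OF m(1)] s unfolding matches_iff[OF x] by (simp add: in_dom_def)
    then show "\<exists>m<s. 0 < p m \<and> matches w (p m - 1) b s"
      using m(1) M(1) S(1)[OF m(1)] s by (auto intro!: exI[of _ m])
  qed
  then show ?thesis by blast
qed

lemma component_prod_decode:
  "component (\<lambda>z. f (fst (prod_decode z)) (snd (prod_decode z))) i = f i"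
  by (simp add: component_def)

lemma in_rep_jump_iff:
  "in_rep (jump F) p = Some x \<longleftrightarrow> (\<exists>q. component p \<longlonglongrightarrow> q \<and> in_rep F q = Some x)"
  by (simp add: jump_def map_comp_Some_iff lim_baire_eq_Some_iff)

lemma jump_simps: "out_rep (jump F) = out_rep F" "mv (jump F) = mv F"
  by (simp_all add: jump_def)

lemma computable_id: "computable (\<lambda>q. Some q)"
  by (rule computable_if_comp_fun[of "\<lambda>q. q"]) (intro comp_intros)

text \<open>Every cylinder is presumed to meet the set until it is seen to be covered. The odd
  positions copy the negative name.\<close>

definition full_name_approx :: "(nat \<Rightarrow> bool list) \<Rightarrow> baire \<Rightarrow> nat \<Rightarrow> baire" where
  "full_name_approx w p s j =
     (if even j then if covered w p (j div 2) s then 0 else Suc (j div 2) else p (j div 2))"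

text \<open>Each entry stabilizes: a cylinder that misses \<open>A\<close> is covered at all late
  stages, and one that meets \<open>A\<close> is covered at none.\<close>

lemma full_name_approx_tendsto:
  assumes "surj w" "A_minus w p = Some A"
  shows "\<exists>r. full_name_approx w p \<longlonglongrightarrow> r \<and> A_full w r = Some A"
proof -
  define r where "r j = (if even j then if cylinder (w (j div 2)) \<inter> A = {} then 0 else Suc (j div 2)
      else p (j div 2))" for j
  have A: "A = UNIV - (\<Union>k\<in>{k. Suc k \<in> range p}. cylinder (w k))"
    using assms(2) by (simp add: A_minus_def)
  have "\<exists>S. \<forall>s\<ge>S. full_name_approx w p s j = r j" for j
  proof (cases "cylinder (w (j div 2)) \<inter> A = {}")
    case True
    then obtain S where "\<forall>s\<ge>S. covered w p (j div 2) s"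
      using eventually_covered[of w "j div 2" p] unfolding A by blast
    with True show ?thesis by (auto simp: full_name_approx_def r_def)
  next
    case False
    then have "\<not> covered w p (j div 2) s" for s
      using covered_imp_subset[of w p "j div 2" s] unfolding A by blast
    with False show ?thesis by (auto simp: full_name_approx_def r_def)
  qed
  moreover have "{n. Suc n \<in> range (\<lambda>n. r (2 * n))} = {n. cylinder (w n) \<inter> A \<noteq> {}}"
    by (auto simp: r_def image_iff split: if_splits)
  moreover have "closed A"
    unfolding A by (intro closed_Diff open_UN ballI open_cylinder closed_UNIV)
  moreover have "(\<lambda>n. r (2 * n + 1)) = p" by (simp add: r_def fun_eq_iff)
  ultimately show ?thesis
    using assms by (intro exI[of _ r]) (simp add: LIMSEQ_baire_iff A_full_eq_Some_iff A_plus_eq_Some_iff)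
qed

lemma VCdim_minus_le_jump_VCdim:
  assumes "surj w" "computable_enumeration w"
  shows "VCdim_minus w \<le>sW jump (VCdim w)"
proof (rule sW_leI)
  show "computable (\<lambda>p. Some (\<lambda>z. full_name_approx w p (fst (prod_decode z)) (snd (prod_decode z))))"
    unfolding full_name_approx_def
    by (intro computable_if_comp_fun comp_intros comp_pred_covered assms(2))
  show "computable (\<lambda>q. Some q)" by (rule computable_id)
  fix p A assume "in_rep (VCdim_minus w) p = Some A"
  then have "A_minus w p = Some A" by (simp add: VCdim_minus_def single_valued_problem_def)
  then obtain r where "full_name_approx w p \<longlonglongrightarrow> r" "A_full w r = Some A"
    using full_name_approx_tendsto[OF assms(1)] by blast
  then have "in_rep (jump (VCdim w))
      (\<lambda>z. full_name_approx w p (fst (prod_decode z)) (snd (prod_decode z))) = Some A"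
    unfolding in_rep_jump_iff component_prod_decode
    by (auto simp: VCdim_def single_valued_problem_def)
  then show "\<exists>x'. in_rep (jump (VCdim w))
        (\<lambda>z. full_name_approx w p (fst (prod_decode z)) (snd (prod_decode z))) = Some x' \<and>
      mv (jump (VCdim w)) x' \<noteq> {} \<and>
      (\<forall>q y. out_rep (jump (VCdim w)) q = Some y \<and> y \<in> mv (jump (VCdim w)) x' \<longrightarrow>
        (\<exists>z\<in>mv (VCdim_minus w) A. out_rep (VCdim_minus w) q = Some z))"
    by (auto simp: jump_simps VCdim_def VCdim_minus_def single_valued_problem_def)
qed

section \<open>Counting and the VC dimension\<close>

definition ecard :: "'a set \<Rightarrow> enat" where
  "ecard S = (if finite S then enat (card S) else \<infinity>)"

lemma ecard_image: "inj_on f S \<Longrightarrow> ecard (f ` S) = ecard S"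
  by (simp add: ecard_def card_image finite_image_iff)

lemma enat_le_ecard_iff: "enat n \<le> ecard S \<longleftrightarrow> (\<exists>F\<subseteq>S. finite F \<and> card F = n)"
proof (cases "finite S")
  case True
  then show ?thesis
    by (auto simp: ecard_def intro: card_mono finite_subset dest: obtain_subset_with_card_n)
next
  case False
  then show ?thesis using infinite_arbitrarily_large[OF False, of n] by (auto simp: ecard_def)
qed

text \<open>Positive thresholds suffice because 0 lies below everything.\<close>

lemma enat_eqI_Suc_le:
  assumes "\<And>n. enat (Suc n) \<le> a \<longleftrightarrow> enat (Suc n) \<le> b"
  shows "a = b"
proof -
  have "c \<le> d" if "\<And>n. enat (Suc n) \<le> c \<Longrightarrow> enat (Suc n) \<le> d" for c d
  proof (rule ccontr)
    assume "\<not> c \<le> d"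
    then obtain m where m: "d = enat m" "enat m < c" by (cases d) auto
    then have "enat (Suc m) \<le> c" by (metis eSuc_enat ileI1)
    from that[OF this] m(1) show False by simp
  qed
  then show ?thesis using assms by (meson order_antisym)
qed

lemma ecard_Suc_le: "ecard {n. enat (Suc n) \<le> d} = d"
proof (cases d)
  case (enat k)
  then have "{n. enat (Suc n) \<le> d} = {..<k}" by auto
  with enat show ?thesis by (simp add: ecard_def)
qed (simp add: ecard_def)

section \<open>Shattering and thresholds for the dimension\<close>

lemma shattered_iff:
  assumes "finite F"
  shows "shattered F \<C> \<longleftrightarrow> Pow F \<subseteq> (\<lambda>B. B \<inter> F) ` \<C>"
proof -
  have sub: "(\<lambda>B. B \<inter> F) ` \<C> \<subseteq> Pow F" by auto
  have "card ((\<lambda>B. B \<inter> F) ` \<C>) = card (Pow F) \<longleftrightarrow> (\<lambda>B. B \<inter> F) ` \<C> = Pow F"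
    using card_subset_eq[OF _ sub] assms by auto
  with sub show ?thesis unfolding shattered_def card_Pow[OF assms] by blast
qed

text \<open>Subsets of shattered sets are shattered, so a set of size at least \<open>Suc n\<close>
  can be cut down to this size exactly. For size 0 the equivalence would fail at the empty
  class.\<close>

lemma Suc_le_vc_dim_iff:
  "enat (Suc n) \<le> vc_dim \<C> \<longleftrightarrow>
     (\<exists>F. finite F \<and> card F = Suc n \<and> Pow F \<subseteq> (\<lambda>B. B \<inter> F) ` \<C>)"
proof
  assume le: "enat (Suc n) \<le> vc_dim \<C>"
  have "\<exists>F. finite F \<and> shattered F \<C> \<and> Suc n \<le> card F"
  proof (rule ccontr)
    assume "\<nexists>F. finite F \<and> shattered F \<C> \<and> Suc n \<le> card F"
    then have "vc_dim \<C> \<le> enat n"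
      unfolding vc_dim_def by (intro Sup_least) (auto simp: not_less_eq_eq)
    with le show False by (metis enat_ord_simps(1) not_less_eq_eq order_refl order_trans)
  qed
  then obtain F where F: "finite F" "shattered F \<C>" "Suc n \<le> card F" by blast
  obtain E where E: "E \<subseteq> F" "card E = Suc n" "finite E"
    using obtain_subset_with_card_n[OF F(3)] by metis
  have "S \<in> (\<lambda>B. B \<inter> E) ` \<C>" if "S \<subseteq> E" for S
  proof -
    have "S \<in> (\<lambda>B. B \<inter> F) ` \<C>" using F(1,2) that E(1) by (auto simp: shattered_iff)
    then obtain B where "B \<in> \<C>" "S = B \<inter> F" by blast
    with that E(1) have "S = B \<inter> E" by blast
    with \<open>B \<in> \<C>\<close> show ?thesis by blast
  qed
  with E show "\<exists>F. finite F \<and> card F = Suc n \<and> Pow F \<subseteq> (\<lambda>B. B \<inter> F) ` \<C>" by blast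
next
  assume "\<exists>F. finite F \<and> card F = Suc n \<and> Pow F \<subseteq> (\<lambda>B. B \<inter> F) ` \<C>"
  then obtain F where "finite F" "card F = Suc n" "shattered F \<C>"
    by (auto simp: shattered_iff)
  then show "enat (Suc n) \<le> vc_dim \<C>"
    unfolding vc_dim_def by (intro Sup_upper) (auto intro!: exI[of _ F])
qed

text \<open>The shattered sets are precisely the finite subsets of \<open>G\<close>: a shattered
  \<open>F\<close> must itself occur as a trace.\<close>

lemma vc_dim_Pow: "vc_dim (Pow G) = ecard G"
proof (rule enat_eqI_Suc_le)
  fix n
  have "Pow F \<subseteq> (\<lambda>B. B \<inter> F) ` Pow G \<longleftrightarrow> F \<subseteq> G" for F
  proof
    assume "Pow F \<subseteq> (\<lambda>B. B \<inter> F) ` Pow G"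
    then have "F \<in> (\<lambda>B. B \<inter> F) ` Pow G" by blast
    then show "F \<subseteq> G" by blast
  next
    assume "F \<subseteq> G"
    have "S \<in> (\<lambda>B. B \<inter> F) ` Pow G" if "S \<subseteq> F" for S
      using that \<open>F \<subseteq> G\<close> by (intro image_eqI[of _ _ S]) auto
    then show "Pow F \<subseteq> (\<lambda>B. B \<inter> F) ` Pow G" by blast
  qed
  then show "enat (Suc n) \<le> vc_dim (Pow G) \<longleftrightarrow> enat (Suc n) \<le> ecard G"
    by (auto simp: Suc_le_vc_dim_iff enat_le_ecard_iff)
qed

section \<open>Sorted sequences and names of extended natural numbers\<close>

text \<open>A sorted sequence has its first one at position \<open>card {i. \<not> x i}\<close>, or
  no one at all, so it already is a name of the number of zeros.\<close>

lemma N_infinity_if_sort_map: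
  assumes "cantor_rep q = Some (sort_map x)"
  shows "N_infinity q = Some (ecard {i. \<not> x i})"
proof -
  have q: "q n = 0 \<or> q n = 1" "q n = 1 \<longleftrightarrow> sort_map x n" for n
    using assms by (auto simp: cantor_rep_def fun_eq_iff split: if_splits)
  show ?thesis
  proof (cases "finite {i. \<not> x i}")
    case True
    then have "q n = 1 \<longleftrightarrow> card {i. \<not> x i} \<le> n" for n
      using q(2)[of n] by (simp add: sort_map_def)
    then show ?thesis using q(1) True
      by (auto simp: ecard_def N_infinity_eq_Some_enat_iff not_le[symmetric])
  next
    case False
    then have "q n = 0" for n using q[of n] by (simp add: sort_map_def)
    then show ?thesis using False by (simp add: ecard_def N_infinity_eq_Some_infinity_iff)
  qed
qed

text \<open>A name may continue arbitrarily after its first one, so the running disjunction is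
  taken. The bound \<open>Suc j\<close> includes position \<open>j\<close> itself.\<close>

lemma sort_map_if_N_infinity:
  assumes "N_infinity q = Some (ecard {i. \<not> x i})"
  shows "cantor_rep (\<lambda>j. if \<exists>i<Suc j. q i \<noteq> 0 then 1 else 0) = Some (sort_map x)"
proof -
  have "(\<exists>i<Suc j. q i \<noteq> 0) \<longleftrightarrow> sort_map x j" for j
  proof (cases "finite {i. \<not> x i}")
    case True
    with assms have q: "\<forall>i<card {i. \<not> x i}. q i = 0" "q (card {i. \<not> x i}) = 1"
      by (auto simp: ecard_def N_infinity_eq_Some_enat_iff)
    have "(\<exists>i<Suc j. q i \<noteq> 0) \<longleftrightarrow> card {i. \<not> x i} \<le> j"
    proof
      assume "\<exists>i<Suc j. q i \<noteq> 0"
      then show "card {i. \<not> x i} \<le> j"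
        using q(1) by (meson le_less_trans less_Suc_eq_le not_le order_trans)
    next
      assume "card {i. \<not> x i} \<le> j"
      then show "\<exists>i<Suc j. q i \<noteq> 0"
        using q(2) by (intro exI[of _ "card {i. \<not> x i}"]) auto
    qed
    with True show ?thesis by (simp add: sort_map_def)
  next
    case False
    with assms have "q i = 0" for i by (simp add: ecard_def N_infinity_eq_Some_infinity_iff)
    with False show ?thesis by (simp add: sort_map_def)
  qed
  then show ?thesis by (auto simp: cantor_rep_def)
qed

section \<open>The VC dimension as a number of zeros\<close>

text \<open>The bits of \<open>f\<close> below \<open>N\<close> form the candidate set and
  \<open>b\<close> prescribes a trace on it. Each trace must be realized by a word listed among the
  first \<open>t\<close> entries of the positive half of \<open>r\<close> and long enough to decide
  all \<open>i < N\<close>.\<close>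

definition shatter_test ::
    "(nat \<Rightarrow> bool list) \<Rightarrow> baire \<Rightarrow> nat \<Rightarrow> nat \<Rightarrow> nat \<Rightarrow> nat \<Rightarrow> bool" where
  "shatter_test w r j f N t \<longleftrightarrow> (\<Sum>i<N. f div 2 ^ i mod 2) = Suc j \<and>
     (\<forall>b<2 ^ N. \<exists>m<t. 0 < r (2 * m) \<and> (\<forall>i<N. in_dom w (r (2 * m) - 1) i \<and>
        (odd (f div 2 ^ i) \<longrightarrow> (has_one w (r (2 * m) - 1) i \<longleftrightarrow> odd (b div 2 ^ i :: nat)))))"

lemma sum_bits_eq_card: "(\<Sum>i<N. f div 2 ^ i mod 2 :: nat) = card {i. i < N \<and> odd (f div 2 ^ i)}"
proof -
  have "card {i. i < N \<and> odd (f div 2 ^ i)} = (\<Sum>i\<in>{i\<in>{..<N}. odd (f div 2 ^ i)}. 1)"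
    by simp
  also have "\<dots> = (\<Sum>i<N. if odd (f div 2 ^ i) then 1 else 0)"
    by (rule sum.inter_filter) simp
  also have "\<dots> = (\<Sum>i<N. f div 2 ^ i mod 2)"
    by (intro sum.cong) (auto simp: odd_iff_mod_2_eq_one)
  finally show ?thesis by simp
qed

lemma shatter_test_sound:
  assumes "shatter_test w r j f N t"
    and A: "{n. Suc n \<in> range (\<lambda>m. r (2 * m))} = {n. cylinder (w n) \<inter> A \<noteq> {}}"
  shows "enat (Suc j) \<le> vc_dim (Collect ` A)"
  unfolding Suc_le_vc_dim_iff
proof (intro exI conjI subsetI)
  define F where "F = {i. i < N \<and> odd (f div 2 ^ i)}"
  show "finite F" by (simp add: F_def)
  show "card F = Suc j" using assms(1) by (simp add: shatter_test_def sum_bits_eq_card F_def)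
  fix S assume "S \<in> Pow F"
  obtain b :: nat where b: "b < 2 ^ N" "\<forall>i<N. odd (b div 2 ^ i) \<longleftrightarrow> i \<in> S"
    using ex_nat_bits[of N "\<lambda>i. i \<in> S"] by blast
  obtain m where m: "0 < r (2 * m)" "\<forall>i<N. in_dom w (r (2 * m) - 1) i \<and>
      (odd (f div 2 ^ i) \<longrightarrow> (has_one w (r (2 * m) - 1) i \<longleftrightarrow> odd (b div 2 ^ i)))"
    using assms(1) b(1) unfolding shatter_test_def by blast
  have "r (2 * m) - 1 \<in> {n. Suc n \<in> range (\<lambda>m. r (2 * m))}" using m(1) by auto
  \<comment> \<open>A listed cylinder meets \<open>A\<close>, and a common point has the prescribed
    trace because the word decides all positions below \<open>N\<close>.\<close>
  then obtain x where x: "x \<in> cylinder (w (r (2 * m) - 1))" "x \<in> A" unfolding A by blast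
  have "x i \<longleftrightarrow> i \<in> S" if "i \<in> F" for i
    using that m(2) b(2) x(1) unfolding mem_cylinder_iff F_def by blast
  then have "S = Collect x \<inter> F" using \<open>S \<in> Pow F\<close> by blast
  then show "S \<in> (\<lambda>B. B \<inter> F) ` Collect ` A" using x(2) by blast
qed

lemma shatter_test_complete:
  assumes "enat (Suc j) \<le> vc_dim (Collect ` A)" "surj w"
    and A: "{n. Suc n \<in> range (\<lambda>m. r (2 * m))} = {n. cylinder (w n) \<inter> A \<noteq> {}}"
  shows "\<exists>f N t. shatter_test w r j f N t"
proof -
  obtain F where F: "finite F" "card F = Suc j" "Pow F \<subseteq> (\<lambda>B. B \<inter> F) ` Collect ` A"
    using assms(1) unfolding Suc_le_vc_dim_iff by blast
  obtain N where N: "\<forall>i\<in>F. i < N" using F(1) finite_nat_set_iff_bounded by blast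
  obtain f :: nat where f: "\<forall>i<N. odd (f div 2 ^ i) \<longleftrightarrow> i \<in> F"
    using ex_nat_bits[of N "\<lambda>i. i \<in> F"] by blast
  have FN: "{i. i < N \<and> odd (f div 2 ^ i)} = F" using f N by blast
  have "\<exists>m. 0 < r (2 * m) \<and> (\<forall>i<N. in_dom w (r (2 * m) - 1) i \<and>
      (odd (f div 2 ^ i) \<longrightarrow> (has_one w (r (2 * m) - 1) i \<longleftrightarrow> odd (b div 2 ^ i))))" for b :: nat
  proof -
    have "{i\<in>F. odd (b div 2 ^ i)} \<in> Pow F" by simp
    then have "{i\<in>F. odd (b div 2 ^ i)} \<in> (\<lambda>B. B \<inter> F) ` Collect ` A"
      using F(3) by (rule rev_subsetD)
    then obtain x where x: "x \<in> A" "{i\<in>F. odd (b div 2 ^ i)} = Collect x \<inter> F" by blast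
    \<comment> \<open>The cylinder of this prefix contains \<open>x\<close> and hence meets
      \<open>A\<close>, so the positive name must list it.\<close>
    obtain n where n: "w n = map x [0..<N]" using \<open>surj w\<close> by (metis surjD)
    have "x \<in> cylinder (w n)" by (simp add: n cylinder_def)
    then have "n \<in> {n. Suc n \<in> range (\<lambda>m. r (2 * m))}" using x(1) unfolding A by blast
    then obtain m where m: "r (2 * m) = Suc n" by auto
    have "in_dom w n i \<and> (odd (f div 2 ^ i) \<longrightarrow> (has_one w n i \<longleftrightarrow> odd (b div 2 ^ i)))"
      if "i < N" for i
      using x(2) f that by (auto simp: in_dom_def has_one_def n)
    then show ?thesis using m by (intro exI[of _ m]) simp
  qed
  then obtain m where m: "\<And>b :: nat. 0 < r (2 * m b) \<and> (\<forall>i<N. in_dom w (r (2 * m b) - 1) i \<and>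
      (odd (f div 2 ^ i) \<longrightarrow> (has_one w (r (2 * m b) - 1) i \<longleftrightarrow> odd (b div 2 ^ i))))"
    by metis
  \<comment> \<open>Only finitely many patterns \<open>b < 2 ^ N\<close> occur, so one search bound
    serves them all.\<close>
  obtain t where t: "\<forall>k\<in>m ` {..<2 ^ N}. k < t" using finite_nat_set_iff_bounded by blast
  have "shatter_test w r j f N t"
    unfolding shatter_test_def sum_bits_eq_card FN using F(2) m t by blast
  then show ?thesis by blast
qed

definition shatter_witness :: "(nat \<Rightarrow> bool list) \<Rightarrow> baire \<Rightarrow> nat \<Rightarrow> nat \<Rightarrow> bool" where
  "shatter_witness w r j s \<longleftrightarrow> shatter_test w r j (fst (prod_decode s))
     (fst (prod_decode (snd (prod_decode s)))) (snd (prod_decode (snd (prod_decode s))))"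

lemma ex_shatter_witness_iff:
  assumes "surj w" "A_full w r = Some A"
  shows "(\<exists>s. shatter_witness w r j s) \<longleftrightarrow> enat (Suc j) \<le> vc_dim (Collect ` A)"
proof -
  have A: "{n. Suc n \<in> range (\<lambda>m. r (2 * m))} = {n. cylinder (w n) \<inter> A \<noteq> {}}"
    using assms by (simp add: A_full_eq_Some_iff A_plus_eq_Some_iff)
  have "(\<exists>s. shatter_witness w r j s) \<longleftrightarrow> (\<exists>f N t. shatter_test w r j f N t)"
  proof
    assume "\<exists>f N t. shatter_test w r j f N t"
    then obtain f N t where "shatter_test w r j f N t" by blast
    then have "shatter_witness w r j (prod_encode (f, prod_encode (N, t)))"
      by (simp add: shatter_witness_def)
    then show "\<exists>s. shatter_witness w r j s" by blast
  qed (auto simp: shatter_witness_def)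
  also have "\<dots> \<longleftrightarrow> enat (Suc j) \<le> vc_dim (Collect ` A)"
    using shatter_test_sound[OF _ A] shatter_test_complete[OF _ assms(1) A] by blast
  finally show ?thesis .
qed

text \<open>Each \<open>j\<close> below the dimension contributes exactly one zero, at its first witness.\<close>

definition vc_bits :: "(nat \<Rightarrow> bool list) \<Rightarrow> baire \<Rightarrow> baire" where
  "vc_bits w r k =
     (if shatter_witness w r (fst (prod_decode k)) (snd (prod_decode k)) \<and>
         (\<forall>s<snd (prod_decode k). \<not> shatter_witness w r (fst (prod_decode k)) s) then 0 else 1)"

text \<open>The projection of a zero to its \<open>j\<close> is injective, since first witnesses are
  unique, and its image consists of the \<open>j\<close> below the dimension.\<close>

lemma ecard_zeros_vc_bits:
  assumes "surj w" "A_full w r = Some A"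
  shows "ecard {k. vc_bits w r k \<noteq> 1} = vc_dim (Collect ` A)"
proof -
  let ?Z = "{k. vc_bits w r k \<noteq> 1}" and ?j = "\<lambda>k. fst (prod_decode k)"
  have Z: "k \<in> ?Z \<longleftrightarrow> shatter_witness w r (?j k) (snd (prod_decode k)) \<and>
      (\<forall>s<snd (prod_decode k). \<not> shatter_witness w r (?j k) s)" for k
    by (simp add: vc_bits_def)
  have "inj_on ?j ?Z"
  proof (rule inj_onI)
    fix k l assume "k \<in> ?Z" "l \<in> ?Z" and eq: "?j k = ?j l"
    then have "snd (prod_decode k) = snd (prod_decode l)"
      unfolding Z by (metis linorder_neqE_nat)
    with eq show "k = l" by (metis prod_eqI prod_decode_eq)
  qed
  moreover have "?j ` ?Z = {j. enat (Suc j) \<le> vc_dim (Collect ` A)}"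
    unfolding ex_shatter_witness_iff[OF assms, symmetric]
  proof (intro equalityI subsetI)
    fix j assume "j \<in> {j. \<exists>s. shatter_witness w r j s}"
    then have "\<exists>s. shatter_witness w r j s" by blast
    then obtain s where "shatter_witness w r j s" "\<forall>s'<s. \<not> shatter_witness w r j s'"
      using exists_least_iff[of "shatter_witness w r j"] by blast
    then have "prod_encode (j, s) \<in> ?Z" unfolding Z by simp
    then show "j \<in> ?j ` ?Z" by (rule rev_image_eqI) simp
  next
    fix j assume "j \<in> ?j ` ?Z"
    then show "j \<in> {j. \<exists>s. shatter_witness w r j s}" unfolding image_iff Bex_def Z by blast
  qed
  ultimately show ?thesis using ecard_image ecard_Suc_le by metis
qed

text \<open>The components of \<open>p\<close> need not be names of anything, but
  \<open>vc_bits\<close> is total and can be applied to each of them; continuity makes the results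
  converge to \<open>vc_bits\<close> of the limit.\<close>

lemma jump_VCdim_le_jump_SORT:
  assumes "surj w" "computable_enumeration w"
  shows "jump (VCdim w) \<le>sW jump SORT"
proof (rule sW_leI)
  let ?k = "\<lambda>p z. vc_bits w (component p (fst (prod_decode z))) (snd (prod_decode z))"
  note rules = computable_if_comp_fun comp_intros comp_pred_in_dom comp_pred_has_one assms(2)
  show "computable (\<lambda>p. Some (?k p))"
    unfolding vc_bits_def shatter_witness_def shatter_test_def component_def by (intro rules)
  \<comment> \<open>The preceding claim concerns the application to all components at once; this one
    supplies the continuity.\<close>
  have comp: "computable (\<lambda>r. Some (vc_bits w r))"
    unfolding vc_bits_def[abs_def] shatter_witness_def shatter_test_def by (intro rules)
  show "computable (\<lambda>q. Some q)" by (rule computable_id)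
  fix p A assume "in_rep (jump (VCdim w)) p = Some A"
  then obtain r where r: "component p \<longlonglongrightarrow> r" "A_full w r = Some A"
    unfolding in_rep_jump_iff by (auto simp: VCdim_def single_valued_problem_def)
  define x where "x k \<longleftrightarrow> vc_bits w r k = 1" for k
  have "component (?k p) = (\<lambda>i. vc_bits w (component p i))"
    using component_prod_decode[of "\<lambda>i. vc_bits w (component p i)"] by (simp add: fun_eq_iff)
  then have "component (?k p) \<longlonglongrightarrow> vc_bits w r"
    using computable_imp_tendsto[OF comp r(1)] by simp
  moreover have "cantor_rep (vc_bits w r) = Some x"
    by (auto simp: cantor_rep_def vc_bits_def x_def fun_eq_iff)
  ultimately have x: "in_rep (jump SORT) (?k p) = Some x"
    unfolding in_rep_jump_iff by (auto simp: SORT_def single_valued_problem_def)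
  have "ecard {k. \<not> x k} = vc_dim (Collect ` A)"
    using ecard_zeros_vc_bits[OF assms(1) r(2)] by (simp add: x_def)
  then have "N_infinity q = Some (vc_dim (Collect ` A))" if "cantor_rep q = Some (sort_map x)" for q
    using N_infinity_if_sort_map[OF that] by simp
  then show "\<exists>x'. in_rep (jump SORT) (?k p) = Some x' \<and> mv (jump SORT) x' \<noteq> {} \<and>
      (\<forall>q y. out_rep (jump SORT) q = Some y \<and> y \<in> mv (jump SORT) x' \<longrightarrow>
        (\<exists>z\<in>mv (jump (VCdim w)) A. out_rep (jump (VCdim w)) q = Some z))"
    by (intro exI[of _ x])
      (simp add: x jump_simps, simp add: SORT_def VCdim_def single_valued_problem_def)
qed

section \<open>The number of zeros as a VC dimension\<close>

text \<open>
  For a convergent sequence \<open>p\<^sub>0, p\<^sub>1, \<dots>\<close>, the pair of \<open>n\<close> and \<open>s\<close> is stable if \<open>s\<close> is the first stage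
  from which on \<open>p\<^sub>t(n)\<close> is 0. Instability has a witness \<open>t\<close>, so the class of all sets of stable pairs
  is given by negative information.
\<close>

definition unstable :: "baire \<Rightarrow> nat \<Rightarrow> nat \<Rightarrow> bool" where
  "unstable p i t \<longleftrightarrow>
     snd (prod_decode i) \<le> t \<and> p (prod_encode (t, fst (prod_decode i))) \<noteq> 0 \<or>
     0 < snd (prod_decode i) \<and> p (prod_encode (snd (prod_decode i) - 1, fst (prod_decode i))) = 0"

definition stable :: "baire \<Rightarrow> nat set" where
  "stable p = {i. \<forall>t. \<not> unstable p i t}"

lemma mem_stable_iff:
  "prod_encode (n, s) \<in> stable p \<longleftrightarrow>
     (\<forall>t\<ge>s. component p t n = 0) \<and> (s = 0 \<or> component p (s - 1) n \<noteq> 0)"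
  by (auto simp: stable_def unstable_def component_def)

text \<open>Projecting a stable pair to its first component is a bijection onto the zeros of
  \<open>q\<close>: each zero has exactly one first stage of stability.\<close>

lemma ecard_stable:
  assumes "component p \<longlonglongrightarrow> q"
  shows "ecard (stable p) = ecard {n. q n = 0}"
proof -
  let ?n = "\<lambda>i. fst (prod_decode i)"
  have lim: "\<exists>N. \<forall>t\<ge>N. component p t n = q n" for n
    using assms unfolding LIMSEQ_baire_iff by blast
  \<comment> \<open>Stability of the earlier pair makes the value at stage \<open>t - 1\<close>
    zero, which stability of the later pair forbids.\<close>
  have less: False
    if "prod_encode (n, s) \<in> stable p" "prod_encode (n, t) \<in> stable p" "s < t" for n s t
    using that unfolding mem_stable_iff by (cases t) auto
  have "inj_on ?n (stable p)"
  proof (rule inj_onI)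
    fix i j assume ij: "i \<in> stable p" "j \<in> stable p" "?n i = ?n j"
    obtain n s t where "i = prod_encode (n, s)" "j = prod_encode (n, t)"
      using ij(3) by (metis prod.collapse prod_decode_inverse)
    with ij(1,2) less show "i = j" by (metis linorder_neqE_nat)
  qed
  moreover have "?n ` stable p = {n. q n = 0}"
  proof (intro equalityI subsetI)
    fix n assume "n \<in> ?n ` stable p"
    then obtain i where "i \<in> stable p" "n = ?n i" by blast
    then have "prod_encode (n, snd (prod_decode i)) \<in> stable p" by simp
    then obtain s where s: "\<forall>t\<ge>s. component p t n = 0" unfolding mem_stable_iff by blast
    obtain N where "\<forall>t\<ge>N. component p t n = q n" using lim by blast
    with s have "q n = 0" by (metis max.cobounded1 max.cobounded2)
    then show "n \<in> {n. q n = 0}" by simp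
  next
    fix n assume "n \<in> {n. q n = 0}"
    then have "\<exists>s. \<forall>t\<ge>s. component p t n = 0" using lim[of n] by simp
    then obtain s where s: "\<forall>t\<ge>s. component p t n = 0"
        "\<forall>s'<s. \<not> (\<forall>t\<ge>s'. component p t n = 0)"
      unfolding exists_least_iff[of "\<lambda>s. \<forall>t\<ge>s. component p t n = 0"] by (elim exE conjE)
    have "component p (s - 1) n \<noteq> 0" if "s \<noteq> 0"
    proof
      assume 0: "component p (s - 1) n = 0"
      have "component p t n = 0" if "s - 1 \<le> t" for t
      proof (cases "t = s - 1")
        case False
        then show ?thesis using that s(1) by simp
      qed (use 0 in simp)
      then show False using s(2) \<open>s \<noteq> 0\<close> by (metis diff_less neq0_conv zero_less_one)
    qed
    then have "prod_encode (n, s) \<in> stable p" using s(1) unfolding mem_stable_iff by blast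
    then show "n \<in> ?n ` stable p" by (rule rev_image_eqI) simp
  qed
  ultimately show ?thesis using ecard_image by metis
qed

text \<open>The position \<open>z\<close> codes a triple of a word index, an element
  \<open>i\<close> that the word puts into the set, and a witness that \<open>i\<close> is unstable.
  Such a word has only excluded points in its cylinder.\<close>

definition stable_name :: "(nat \<Rightarrow> bool list) \<Rightarrow> baire \<Rightarrow> baire" where
  "stable_name w p z =
     (if has_one w (fst (prod_decode z)) (fst (prod_decode (snd (prod_decode z)))) \<and>
         unstable p (fst (prod_decode (snd (prod_decode z)))) (snd (prod_decode (snd (prod_decode z))))
      then Suc (fst (prod_decode z)) else 0)"

lemma A_minus_stable_name:
  assumes "surj w"
  shows "A_minus w (stable_name w p) = Some {x. Collect x \<subseteq> stable p}"
proof -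
  have range: "Suc n \<in> range (stable_name w p) \<longleftrightarrow> (\<exists>i t. has_one w n i \<and> unstable p i t)" for n
  proof
    assume "\<exists>i t. has_one w n i \<and> unstable p i t"
    then obtain i t where "has_one w n i" "unstable p i t" by blast
    then have "Suc n = stable_name w p (prod_encode (n, prod_encode (i, t)))"
      by (simp add: stable_name_def)
    then show "Suc n \<in> range (stable_name w p)" by blast
  qed (auto simp: stable_name_def split: if_splits)
  have "(\<exists>n. Suc n \<in> range (stable_name w p) \<and> x \<in> cylinder (w n)) \<longleftrightarrow> \<not> Collect x \<subseteq> stable p" for x
  proof
    assume "\<exists>n. Suc n \<in> range (stable_name w p) \<and> x \<in> cylinder (w n)"
    then obtain n i t where "has_one w n i" "unstable p i t" "x \<in> cylinder (w n)"
      unfolding range by blast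
    then have "x i" "i \<notin> stable p"
      by (auto simp: mem_cylinder_iff stable_def in_dom_def has_one_def)
    then show "\<not> Collect x \<subseteq> stable p" by blast
  next
    assume "\<not> Collect x \<subseteq> stable p"
    then obtain i t where i: "x i" "unstable p i t" by (auto simp: stable_def)
    \<comment> \<open>Length \<open>Suc i\<close> is the shortest that decides position
      \<open>i\<close>.\<close>
    obtain n where n: "w n = map x [0..<Suc i]" using \<open>surj w\<close> by (metis surjD)
    have "x \<in> cylinder (w n)" by (simp add: n cylinder_def del: upt_Suc)
    moreover have "has_one w n i" using i(1) by (simp add: has_one_def n del: upt_Suc)
    ultimately show "\<exists>n. Suc n \<in> range (stable_name w p) \<and> x \<in> cylinder (w n)"
      using i(2) unfolding range by blast
  qed
  then show ?thesis unfolding A_minus_def by blast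
qed

text \<open>The jump is absorbed because \<open>stable_name\<close> uses only the converging
  sequence and never its limit. The class it names is the full power set of the stable
  pairs.\<close>

lemma jump_SORT_le_VCdim_minus:
  assumes "surj w" "computable_enumeration w"
  shows "jump SORT \<le>sW VCdim_minus w"
proof (rule sW_leI)
  let ?h = "\<lambda>(q :: baire) j. if \<exists>i<Suc j. q i \<noteq> 0 then 1 else 0"
  show "computable (\<lambda>p. Some (stable_name w p))"
    unfolding stable_name_def[abs_def] unstable_def
    by (intro computable_if_comp_fun comp_intros comp_pred_has_one assms(2))
  show "computable (\<lambda>q. Some (?h q))" by (intro computable_if_comp_fun comp_intros)
  fix p x assume "in_rep (jump SORT) p = Some x"
  then obtain q where q: "component p \<longlonglongrightarrow> q" "cantor_rep q = Some x"
    unfolding in_rep_jump_iff by (auto simp: SORT_def single_valued_problem_def)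
  have "{n. \<not> x n} = {n. q n = 0}"
    using q(2) by (auto simp: cantor_rep_def split: if_splits)
  moreover have "Collect ` {x. Collect x \<subseteq> stable p} = Pow (stable p)"
    by (auto intro!: image_eqI[of _ _ "\<lambda>i. i \<in> _"])
  ultimately have "vc_dim (Collect ` {x. Collect x \<subseteq> stable p}) = ecard {n. \<not> x n}"
    using ecard_stable[OF q(1)] by (simp add: vc_dim_Pow)
  then show "\<exists>C. in_rep (VCdim_minus w) (stable_name w p) = Some C \<and> mv (VCdim_minus w) C \<noteq> {} \<and>
      (\<forall>q y. out_rep (VCdim_minus w) q = Some y \<and> y \<in> mv (VCdim_minus w) C \<longrightarrow>
        (\<exists>z\<in>mv (jump SORT) x. out_rep (jump SORT) (?h q) = Some z))"
    using A_minus_stable_name[OF assms(1)] sort_map_if_N_infinity[of _ x]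
    by (intro exI[of _ "{x. Collect x \<subseteq> stable p}"])
      (simp add: jump_simps VCdim_minus_def SORT_def single_valued_problem_def)
qed

theorem theorem30:
  fixes w :: "nat \<Rightarrow> bool list"
  assumes "bij w" and "computable_enumeration w"
  shows "VCdim_minus w \<equiv>sW jump (VCdim w) \<and> jump (VCdim w) \<equiv>sW jump SORT"
proof -
  have "surj w" using assms(1) by (rule bij_is_surj)
  note cycle = VCdim_minus_le_jump_VCdim[OF this assms(2)]
    jump_VCdim_le_jump_SORT[OF this assms(2)] jump_SORT_le_VCdim_minus[OF this assms(2)]
  then show ?thesis unfolding sW_equiv_def by (blast intro: sW_le_trans)
qed

end
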